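(* Let $m\ge 2$, $n\ge 3$ and let $\mathbb{F}$ be a coefficient ring. Let \[ \Gamma_{m,n} = \{\sigma \in \mathsf{M}_{m,n} : s\bar{1} \notin \sigma \text{ for all } s \in [3,m]\}. \] For each $d$ put \[ Q^{m-2,n-1}_{d} = (1\bar{1} - 2\bar{1}) \otimes \tilde{H}_{d}(\mathsf{M}_{[3,m],[2,n]};\mathbb{F}), \qquad R^{m-2,n-3}_{d} = \bigoplus_{s\neq t\in[2,n]} 1\bar{s}\wedge 2\bar{t}\otimes \tilde{H}_{d}(\mathsf{M}_{[3,m],[2,n]\setminus\{s,t\}};\mathbb{F}), \] where the direct sum is over ordered pairs $(s,t)$ of distinct elements of $[2,n]$, and $Q^{m-2,n-1}_d$ is a copy of $\tilde{H}_{d}(\mathsf{M}_{[3,m],[2,n]};\mathbb{F})$. Then there is a long exact sequence \[ \cdots \to R^{m-2,n-3}_{d-1} \xrightarrow{\varphi^*} Q^{m-2,n-1}_{d-1} \xrightarrow{\iota^*} \tilde{H}_{d}(\Gamma_{m,n};\mathbb{F}) \to R^{m-2,n-3}_{d-2} \to Q^{m-2,n-1}_{d-2} \to \cdots, \] where $\varphi^*$ is induced by the map $\varphi(1\bar{s}\wedge 2\bar{t}\otimes x) = (1\bar{1}-2\bar{1})\otimes x$ (the homology class $x$ of $\mathsf{M}_{[3,m],[2,n]\setminus\{s,t\}}$ being mapped to its image in $\tilde{H}_{d-1}(\mathsf{M}_{[3,m],[2,n]};\mathbb{F})$ under inclusion), and $\iota^*$ is induced by $\iota((1\bar{1}-2\bar{1})\otimes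 x) = (1\bar{1}-2\bar{1})\wedge x$, a cycle in $\Gamma_{m,n}$.
   Context: $K_{m,n}$ is the complete bipartite graph with vertex blocks $[m]=\{1,\dots,m\}$ and $[\bar n]=\{\bar 1,\dots,\bar n\}$. Its edges are written $i\bar{j}$. For $S\subseteq[m]$ and $T\subseteq[n]$, $\mathsf{M}_{S,T}$ is the simplicial complex of matchings in the complete bipartite graph with blocks $S$ and $\bar T$, and $\mathsf{M}_{m,n}=\mathsf{M}_{[m],[n]}$. For integers $a\le b$, $[a,b]=\{a,\dots,b\}$. Homology is reduced simplicial homology. The chain generated by a face $\{e_0,\dots,e_d\}$ is written $e_0\wedge\cdots\wedge e_d$. For chains $c,c'$ on disjoint vertex sets, $c\wedge c'$ denotes the bilinear extension of concatenation of such wedges (the join of the chains). *)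

theory Defs
  imports
    "HOL-Algebra.Product_Groups"
    "HOL-Algebra.Exact_Sequence"
    "HOL-Algebra.Algebraic_Closure_Type"
    "HOL-Library.Poly_Mapping"
    "HOL-Library.Product_Lexorder"
begin

hide_const (open) Polynomial.smult

section \<open>Modules\<close>

text \<open>
  The library has no quotient modules, direct sums of modules or module homomorphisms as records
  and sets, and its exact sequences live over a single carrier type; the following are the module
  versions of \<^const>\<open>FactRing\<close>, \<^const>\<open>sum_group\<close>, \<^const>\<open>hom\<close> and \<^const>\<open>exact_seq\<close>.
  The ring fields \<open>mult\<close> and \<open>one\<close> of a module record carry no meaning.
\<close>

definition quotient_module :: "('r, 'b, 'c) module_scheme \<Rightarrow> 'b set \<Rightarrow> ('r, 'b set) module" where
  "quotient_module M B =
    \<lparr>carrier = a_rcosets\<^bsub>M\<^esub> B, monoid.mult = undefined, one = undefined,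
     zero = B, add = set_add M,
     smult = (\<lambda>r A. set_add M B ((\<lambda>x. r \<odot>\<^bsub>M\<^esub> x) ` A))\<rparr>"

definition direct_sum :: "'i set \<Rightarrow> ('i \<Rightarrow> ('r, 'b, 'c) module_scheme) \<Rightarrow> ('r, 'i \<Rightarrow> 'b) module" where
  "direct_sum I M =
    \<lparr>carrier = carrier (sum_group I (\<lambda>i. add_monoid (M i))), monoid.mult = undefined, one = undefined,
     zero = (\<lambda>i\<in>I. \<zero>\<^bsub>M i\<^esub>), add = (\<lambda>x y. \<lambda>i\<in>I. x i \<oplus>\<^bsub>M i\<^esub> y i),
     smult = (\<lambda>r x. \<lambda>i\<in>I. r \<odot>\<^bsub>M i\<^esub> x i)\<rparr>"

definition module_hom ::
  "('r, 'd) ring_scheme \<Rightarrow> ('r, 'a, 'e) module_scheme \<Rightarrow> ('r, 'b, 'f) module_scheme \<Rightarrow> ('a \<Rightarrow> 'b) set" where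
  "module_hom R M N =
    {h \<in> hom (add_monoid M) (add_monoid N).
       \<forall>r\<in>carrier R. \<forall>x\<in>carrier M. h (r \<odot>\<^bsub>M\<^esub> x) = r \<odot>\<^bsub>N\<^esub> h x}"

definition exact_at ::
  "('r, 'd) ring_scheme \<Rightarrow> ('r, 'a, 'e) module_scheme \<Rightarrow> ('a \<Rightarrow> 'b) \<Rightarrow> ('r, 'b, 'f) module_scheme
     \<Rightarrow> ('b \<Rightarrow> 'c) \<Rightarrow> ('r, 'c, 'g) module_scheme \<Rightarrow> bool" where
  "exact_at R L f M g N \<longleftrightarrow>
     module R L \<and> module R M \<and> module R N \<and> f \<in> module_hom R L M \<and> g \<in> module_hom R M N \<and>
     f ` carrier L = kernel (add_monoid M) (add_monoid N) g"


section \<open>Simplicial chains\<close>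

text \<open>
  A simplicial complex is a set of finite sets closed under subsets (so it contains the empty face
  unless it is void). Chains with coefficients in \<open>'f\<close> are finitely supported functions on faces;
  the basis element at a face is the wedge of its vertices in increasing order.
\<close>

type_synonym ('v, 'f) chain = "'v set \<Rightarrow>\<^sub>0 'f"

definition scale :: "'f::comm_ring_1 \<Rightarrow> ('v, 'f) chain \<Rightarrow> ('v, 'f) chain" where
  "scale r c = Poly_Mapping.map (\<lambda>a. r * a) c"

text \<open>\<open>wedge [e\<^sub>0, \<dots>, e\<^sub>d]\<close> is the chain \<open>e\<^sub>0 \<and> \<dots> \<and> e\<^sub>d\<close>: the sign is that of the sorting permutation.\<close>

definition inversions :: "'v::linorder list \<Rightarrow> (nat \<times> nat) set" where
  "inversions es = {(i, j). i < j \<and> j < length es \<and> es ! j < es ! i}"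

definition wedge :: "'v::linorder list \<Rightarrow> ('v, 'f::comm_ring_1) chain" where
  "wedge es =
    (if distinct es then Poly_Mapping.single (set es) ((- 1) ^ card (inversions es)) else 0)"

text \<open>
  The vertices of a face are removed one at a time, with alternating signs. A single vertex has
  boundary \<open>wedge []\<close>, the generator of degree \<open>- 1\<close>, so the homology below is reduced.
\<close>

definition boundary :: "('v::linorder, 'f::comm_ring_1) chain \<Rightarrow> ('v, 'f) chain" where
  "boundary c =
    (\<Sum>\<sigma>\<in>Poly_Mapping.keys c. scale (Poly_Mapping.lookup c \<sigma>)
      (let es = sorted_list_of_set \<sigma> in
        \<Sum>i<length es. scale ((- 1) ^ i) (wedge (take i es @ drop (Suc i) es))))"

text \<open>The bilinear extension of concatenation of wedges.\<close>

definition join :: "('v::linorder, 'f::comm_ring_1) chain \<Rightarrow> ('v, 'f) chain \<Rightarrow> ('v, 'f) chain"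
    (infixr \<open>\<^bold>\<and>\<close> 70) where
  "c \<^bold>\<and> c' =
    (\<Sum>\<sigma>\<in>Poly_Mapping.keys c. \<Sum>\<tau>\<in>Poly_Mapping.keys c'. scale (Poly_Mapping.lookup c \<sigma> * Poly_Mapping.lookup c' \<tau>)
      (wedge (sorted_list_of_set \<sigma> @ sorted_list_of_set \<tau>)))"


section \<open>Reduced simplicial homology\<close>

abbreviation coeff_ring :: "'f::comm_ring_1 ring" where
  "coeff_ring \<equiv> ring_of_type_algebra"

definition chain_module :: "'v set set \<Rightarrow> int \<Rightarrow> ('f::comm_ring_1, ('v, 'f) chain) module" where
  "chain_module K d =
    \<lparr>carrier = {c. \<forall>\<sigma>\<in>Poly_Mapping.keys c. \<sigma> \<in> K \<and> finite \<sigma> \<and> int (card \<sigma>) = d + 1},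
     monoid.mult = undefined, one = undefined, zero = 0, add = (+), smult = scale\<rparr>"

definition cycles :: "'v::linorder set set \<Rightarrow> int \<Rightarrow> ('v, 'f::comm_ring_1) chain set" where
  "cycles K d = {c \<in> carrier (chain_module K d). boundary c = 0}"

definition boundaries :: "'v::linorder set set \<Rightarrow> int \<Rightarrow> ('v, 'f::comm_ring_1) chain set" where
  "boundaries K d = boundary ` carrier (chain_module K (d + 1))"

definition reduced_homology ::
  "'v::linorder set set \<Rightarrow> int \<Rightarrow> ('f::comm_ring_1, ('v, 'f) chain set) module" where
  "reduced_homology K d =
    quotient_module ((chain_module K d)\<lparr>carrier := cycles K d\<rparr>) (boundaries K d)"

text \<open>
  The map into \<open>reduced_homology L d\<close> induced by a map \<open>f\<close> of chains: the class of a cycle \<open>z\<close> goes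
  to the class \<open>f z + boundaries L d\<close>. Applied to a whole class \<open>A\<close>, the set \<open>f ` A + boundaries L d\<close>
  is this coset whenever \<open>f\<close> is additive and sends boundaries to boundaries.
\<close>

definition induced_map ::
  "(('v::linorder, 'f::comm_ring_1) chain \<Rightarrow> ('v, 'f) chain) \<Rightarrow> 'v set set \<Rightarrow> int
     \<Rightarrow> ('v, 'f) chain set \<Rightarrow> ('v, 'f) chain set" where
  "induced_map f L d A = set_add (chain_module L d) (boundaries L d) (f ` A)"


section \<open>Matching complexes\<close>

text \<open>
  The edge between \<open>i\<close> in the first and \<open>j\<close> in the second block is the pair \<open>(i, j)\<close>; edges are
  ordered lexicographically.
\<close>

type_synonym edge = "nat \<times> nat"

definition matching_complex :: "nat set \<Rightarrow> nat set \<Rightarrow> edge set set" where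
  "matching_complex S T =
    {\<sigma>. \<sigma> \<subseteq> S \<times> T \<and> (\<forall>e\<in>\<sigma>. \<forall>e'\<in>\<sigma>. e \<noteq> e' \<longrightarrow> fst e \<noteq> fst e' \<and> snd e \<noteq> snd e')}"

definition Gamma_complex :: "nat \<Rightarrow> nat \<Rightarrow> edge set set" where
  "Gamma_complex m n = {\<sigma> \<in> matching_complex {1..m} {1..n}. \<forall>s\<in>{3..m}. (s, 1) \<notin> \<sigma>}"

text \<open>
  \<open>Q_module m n d\<close> is \<open>Q\<^sub>d\<close> with superscript \<open>(m - 2, n - 1)\<close> and \<open>R_module m n d\<close> is \<open>R\<^sub>d\<close> with
  superscript \<open>(m - 2, n - 3)\<close>. An element \<open>(1,1) - (2,1) \<otimes> x\<close> of \<open>Q\<^sub>d\<close> is represented by \<open>x\<close>,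
  and the summand of \<open>R\<^sub>d\<close> labelled \<open>(1,s) \<and> (2,t)\<close> is the one with index \<open>(s, t)\<close>.
\<close>

definition Q_complex :: "nat \<Rightarrow> nat \<Rightarrow> edge set set" where
  "Q_complex m n = matching_complex {3..m} {2..n}"

definition Q_module :: "nat \<Rightarrow> nat \<Rightarrow> int \<Rightarrow> ('f::comm_ring_1, (edge, 'f) chain set) module" where
  "Q_module m n d = reduced_homology (Q_complex m n) d"

definition R_index :: "nat \<Rightarrow> (nat \<times> nat) set" where
  "R_index n = {(s, t). s \<in> {2..n} \<and> t \<in> {2..n} \<and> s \<noteq> t}"

definition R_module ::
  "nat \<Rightarrow> nat \<Rightarrow> int \<Rightarrow> ('f::comm_ring_1, nat \<times> nat \<Rightarrow> (edge, 'f) chain set) module" where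
  "R_module m n d =
    direct_sum (R_index n)
      (\<lambda>(s, t). reduced_homology (matching_complex {3..m} ({2..n} - {s, t})) d)"

text \<open>The linear extension of \<open>(1,s) \<and> (2,t) \<otimes> x \<mapsto> (1,1) - (2,1) \<otimes> incl x\<close>.\<close>

definition phi_star ::
  "nat \<Rightarrow> nat \<Rightarrow> int \<Rightarrow> (nat \<times> nat \<Rightarrow> (edge, 'f::comm_ring_1) chain set) \<Rightarrow> (edge, 'f) chain set" where
  "phi_star m n d x =
    (\<Oplus>\<^bsub>Q_module m n d\<^esub>p\<in>R_index n. induced_map (\<lambda>z. z) (Q_complex m n) d (x p))"

definition iota :: "(edge, 'f::comm_ring_1) chain \<Rightarrow> (edge, 'f) chain" where
  "iota z = (wedge [(1, 1)] - wedge [(2, 1)]) \<^bold>\<and> z"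

definition iota_star ::
  "nat \<Rightarrow> nat \<Rightarrow> int \<Rightarrow> (edge, 'f::comm_ring_1) chain set \<Rightarrow> (edge, 'f) chain set" where
  "iota_star m n d = induced_map iota (Gamma_complex m n) (d + 1)"

end

theory Submission
  imports Defs
begin

text \<open>
  A face of \<open>\<Gamma>\<close> has at most one edge at each of the vertices 1 and 2, and collapsing the faces that can
  be completed by \<open>(1,1)\<close> or \<open>(2,1)\<close> leaves only the faces \<open>(2,1) \<union> \<tau>\<close> and \<open>(1,s), (2,t) \<union> \<tau>\<close>. On chains:
  the chain complex of \<open>\<Gamma>\<close> is homotopy equivalent to the mapping cone of the sum of inclusions
  \<open>\<phi>\<close> from the chains of the complexes \<open>M\<^bsub>[3,m],[2,n]-{s,t}\<^esub>\<close> (shifted by two) to those of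
  \<open>M\<^bsub>[3,m],[2,n]\<^esub>\<close> (shifted by one). The maps \<open>Q_part\<close> and \<open>R_part\<close> project onto the two summands of
  the cone, \<open>iota\<close> and \<open>kappa\<close> include them, \<open>contraction\<close> is the homotopy, and the sequence is
  the long exact sequence of the cone, with \<open>R_part\<close> inducing the third map.
\<close>

section \<open>Linear maps of chains\<close>

text \<open>In \<Gamma> no edge of a row from 3 on lies in column 1, so \<open>(1,1)\<close> or
  \<open>(2,1)\<close> can be added to a face as soon as the row concerned is free and the other of
  the two edges is absent. This is what makes the collapse possible. Among the surviving faces, the
  gradient paths from \<open>(1,s), (2,t) \<union> \<tau>\<close> reach
  \<open>(2,1) \<union> \<tau>\<close> in one way only: delete \<open>(2,t)\<close>, add
  \<open>(2,1)\<close>, delete \<open>(1,s)\<close>. Deleting \<open>(1,s)\<close> at the start and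
  then adding \<open>(1,1)\<close> leads to \<open>(1,1) \<union> \<tau>\<close>, which is paired
  downwards with \<tau>, and the path stops. Each pair \<open>(s,t)\<close> thus contributes its
  inclusion exactly once, and the cone differential is the plain sum \<phi>. The obstacle on chains
  is signs. In the lexicographic order the edges of rows 1 and 2 precede all others, so every map
  can be assembled from the sign-free operation of prepending a smallest vertex. All maps being
  explicit, exactness is checked on representatives.\<close>

abbreviation basis :: "'v set \<Rightarrow> ('v, 'f::comm_ring_1) chain" where
  "basis \<sigma> \<equiv> Poly_Mapping.single \<sigma> 1"

definition chain_linear ::
  "(('v, 'f::comm_ring_1) chain \<Rightarrow> ('w, 'f) chain) \<Rightarrow> bool" where
  "chain_linear f \<longleftrightarrow> (\<forall>x y. f (x + y) = f x + f y) \<and> (\<forall>r x. f (scale r x) = scale r (f x))"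

text \<open>Linear extension from the basis of faces. \<open>boundary\<close>, \<open>join\<close>,
  \<open>prepend\<close> and \<open>head_part\<close> all have this shape, so one linearity proof
  serves them all.\<close>

definition extend ::
  "('v set \<Rightarrow> ('w, 'f::comm_ring_1) chain) \<Rightarrow> ('v, 'f) chain \<Rightarrow> ('w, 'f) chain" where
  "extend f c = (\<Sum>\<sigma>\<in>Poly_Mapping.keys c. scale (Poly_Mapping.lookup c \<sigma>) (f \<sigma>))"

lemma lookup_scale [simp]:
  "Poly_Mapping.lookup (scale r c) \<sigma> = r * Poly_Mapping.lookup c \<sigma>"
  by (simp add: scale_def map.rep_eq when_def)

lemma scale_simps [simp]:
  "scale r 0 = 0" "scale 0 c = 0" "scale 1 c = c"
  "scale r (scale s c) = scale (r * s) c" "scale r (- c) = - scale r c"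
  by (auto intro!: poly_mapping_eqI simp: algebra_simps)

lemma scale_add_right: "scale r (c + c') = scale r c + scale r c'"
  and scale_add_left: "scale (r + s) c = scale r c + scale s c"
  and scale_diff_right: "scale r (c - c') = scale r c - scale r c'"
  and scale_minus_left: "scale (- r) c = - scale r c"
  by (auto intro!: poly_mapping_eqI simp: lookup_add lookup_minus algebra_simps)

lemma scale_sum: "scale r (\<Sum>i\<in>I. f i) = (\<Sum>i\<in>I. scale r (f i))"
  by (induction I rule: infinite_finite_induct) (auto simp: scale_add_right)

lemma keys_scale: "Poly_Mapping.keys (scale r c) \<subseteq> Poly_Mapping.keys c"
  by (auto simp: in_keys_iff)

lemma chain_linear_add: "chain_linear f \<Longrightarrow> f (x + y) = f x + f y"
  and chain_linear_scale: "chain_linear f \<Longrightarrow> f (scale r x) = scale r (f x)"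
  by (auto simp: chain_linear_def)

lemma chain_linear_zero: "chain_linear f \<Longrightarrow> f 0 = 0"
  using chain_linear_scale[of f 0 0] by simp

lemma chain_linear_minus: "chain_linear f \<Longrightarrow> f (- x) = - f x"
  using chain_linear_add[of f x "- x"] chain_linear_zero[of f] by (simp add: eq_neg_iff_add_eq_0 add.commute)

lemma chain_linear_diff: "chain_linear f \<Longrightarrow> f (x - y) = f x - f y"
  using chain_linear_add[of f x "- y"] chain_linear_minus[of f y] by simp

lemma chain_linear_sum: "chain_linear f \<Longrightarrow> f (\<Sum>i\<in>I. x i) = (\<Sum>i\<in>I. f (x i))"
  by (induction I rule: infinite_finite_induct) (auto simp: chain_linear_zero chain_linear_add)

lemma extend_superset:
  assumes "finite A" "Poly_Mapping.keys c \<subseteq> A"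
  shows "extend f c = (\<Sum>\<sigma>\<in>A. scale (Poly_Mapping.lookup c \<sigma>) (f \<sigma>))"
  unfolding extend_def using assms
  by (intro sum.mono_neutral_left) (auto simp: in_keys_iff)

lemma extend_linear: "chain_linear (extend (f :: 'v set \<Rightarrow> ('w, 'f::comm_ring_1) chain))"
  unfolding chain_linear_def
proof (intro conjI allI)
  fix x y :: "('v, 'f) chain"
  let ?A = "Poly_Mapping.keys x \<union> Poly_Mapping.keys y"
  show "extend f (x + y) = extend f x + extend f y"
    using keys_add[of x y]
    by (simp add: extend_superset[where A = ?A] lookup_add scale_add_left sum.distrib)
next
  fix r and x :: "('v, 'f) chain"
  show "extend f (scale r x) = scale r (extend f x)"
    using keys_scale[of r x]
    by (simp add: extend_superset[where A = "Poly_Mapping.keys x"] scale_sum)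
qed

lemma extend_basis [simp]: "extend f (basis \<sigma>) = f \<sigma>"
  by (simp add: extend_def)

lemma sum_basis: "(\<Sum>\<sigma>\<in>Poly_Mapping.keys c. scale (Poly_Mapping.lookup c \<sigma>) (basis \<sigma>)) = c"
  by (rule poly_mapping_eqI)
    (auto simp: lookup_sum lookup_single when_def in_keys_iff if_distrib sum.delta' cong: if_cong)

text \<open>Asking for agreement only on the support of \<open>c\<close> lets a property of the
  faces of \<open>c\<close>, such as \<open>above\<close> or lying in \<Gamma>, be used one face at
  a time.\<close>

lemma chain_linear_eqI:
  assumes "chain_linear f" "chain_linear g"
    and "\<And>\<sigma>. \<sigma> \<in> Poly_Mapping.keys c \<Longrightarrow> f (basis \<sigma>) = g (basis \<sigma>)"
  shows "f c = g c"
proof -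
  have "f (\<Sum>\<sigma>\<in>Poly_Mapping.keys c. scale (Poly_Mapping.lookup c \<sigma>) (basis \<sigma>))
      = g (\<Sum>\<sigma>\<in>Poly_Mapping.keys c. scale (Poly_Mapping.lookup c \<sigma>) (basis \<sigma>))"
    by (simp add: chain_linear_sum[OF assms(1)] chain_linear_sum[OF assms(2)]
        chain_linear_scale[OF assms(1)] chain_linear_scale[OF assms(2)] assms(3))
  then show ?thesis by (simp only: sum_basis)
qed

lemma keys_extend: "Poly_Mapping.keys (extend f c) \<subseteq> (\<Union>\<sigma>\<in>Poly_Mapping.keys c. Poly_Mapping.keys (f \<sigma>))"
proof -
  have "Poly_Mapping.keys (extend f c) \<subseteq>
      (\<Union>\<sigma>\<in>Poly_Mapping.keys c. Poly_Mapping.keys (scale (Poly_Mapping.lookup c \<sigma>) (f \<sigma>)))"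
    unfolding extend_def by (rule keys_sum)
  also have "\<dots> \<subseteq> (\<Union>\<sigma>\<in>Poly_Mapping.keys c. Poly_Mapping.keys (f \<sigma>))"
    by (intro UN_mono order_refl keys_scale)
  finally show ?thesis .
qed

section \<open>Wedges, boundaries and prepending a smallest vertex\<close>

lemma wedge_sorted: "sorted es \<Longrightarrow> distinct es \<Longrightarrow> wedge es = basis (set es)"
proof -
  assume "sorted es" "distinct es"
  then have "inversions es = {}"
    by (auto simp: inversions_def sorted_iff_nth_mono not_le) (meson leD less_imp_le_nat)
  then show ?thesis using \<open>distinct es\<close> by (simp add: wedge_def)
qed

text \<open>Insertion of a vertex with no sign; a face that already contains \<open>e\<close> stays
  as it is. On chains with \<open>above e c\<close> it is the wedge by \<open>e\<close>.\<close>

definition prepend :: "'v \<Rightarrow> ('v, 'f::comm_ring_1) chain \<Rightarrow> ('v, 'f) chain" where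
  "prepend e = extend (\<lambda>\<sigma>. basis (insert e \<sigma>))"

definition face_sum :: "'v::linorder set \<Rightarrow> ('v, 'f::comm_ring_1) chain" where
  "face_sum \<sigma> = (let es = sorted_list_of_set \<sigma> in
        \<Sum>i<length es. scale ((- 1) ^ i) (wedge (take i es @ drop (Suc i) es)))"

lemma boundary_eq_extend: "boundary = extend face_sum"
  by (rule ext) (simp add: boundary_def extend_def face_sum_def)

lemma boundary_linear: "chain_linear boundary"
  unfolding boundary_eq_extend by (rule extend_linear)

lemma prepend_linear: "chain_linear (prepend e)"
  unfolding prepend_def by (rule extend_linear)

lemmas chain_linear_simps = chain_linear_add chain_linear_scale chain_linear_zero chain_linear_minus
  chain_linear_diff chain_linear_sum

lemmas boundary_simps = chain_linear_simps[OF boundary_linear]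
lemmas prepend_simps = chain_linear_simps[OF prepend_linear]
lemma chain_linear_intros:
  "chain_linear f \<Longrightarrow> chain_linear g \<Longrightarrow> chain_linear (\<lambda>c. f c + g c)"
  "chain_linear f \<Longrightarrow> chain_linear g \<Longrightarrow> chain_linear (\<lambda>c. f c - g c)"
  "chain_linear f \<Longrightarrow> chain_linear (\<lambda>c. - f c)"
  "(\<And>i. i \<in> I \<Longrightarrow> chain_linear (h i)) \<Longrightarrow> chain_linear (\<lambda>c. \<Sum>i\<in>I. h i c)"
  "chain_linear f \<Longrightarrow> chain_linear (\<lambda>c. prepend e (f c))"
  "chain_linear f \<Longrightarrow> chain_linear (\<lambda>c. boundary (f c))"
  "chain_linear (\<lambda>c. c)"
  by (auto simp: chain_linear_def scale_add_right scale_diff_right scale_sum sum.distrib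
      prepend_simps boundary_simps)

lemmas scale_distribs = scale_add_right scale_diff_right scale_sum

lemma sorted_remove_nth:
  assumes "sorted es" "distinct es"
  shows "sorted (take i es @ drop (Suc i) es) \<and> distinct (take i es @ drop (Suc i) es)"
proof (cases "i < length es")
  case True
  from assms have "sorted (take i es @ es ! i # drop (Suc i) es) \<and> distinct (take i es @ es ! i # drop (Suc i) es)"
    unfolding id_take_nth_drop[OF True, symmetric] by simp
  then show ?thesis by (auto simp only: sorted_append distinct_append sorted_simps distinct.simps set_simps)
qed (use assms in simp)

lemma wedge_remove_nth:
  assumes "sorted es" "distinct es"
  shows "wedge (take i es @ drop (Suc i) es) = basis (set (take i es @ drop (Suc i) es))"
  using sorted_remove_nth[OF assms] by (intro wedge_sorted) auto

lemma keys_face_sum: "Poly_Mapping.keys (face_sum \<sigma>) \<subseteq> {\<tau>. finite \<tau> \<and> \<tau> \<subseteq> \<sigma>}"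
proof (cases "finite \<sigma>")
  case True
  let ?es = "sorted_list_of_set \<sigma>"
  have "Poly_Mapping.keys (face_sum \<sigma> :: ('a, 'b) chain) \<subseteq> (\<Union>i\<in>{..<length ?es}. Poly_Mapping.keys
      (scale ((- 1) ^ i) (wedge (take i ?es @ drop (Suc i) ?es)) :: ('a, 'b) chain))"
    unfolding face_sum_def Let_def by (rule keys_sum)
  also have "\<dots> \<subseteq> (\<Union>i\<in>{..<length ?es}. {set (take i ?es @ drop (Suc i) ?es)})"
    by (intro UN_mono order_refl order_trans[OF keys_scale]) (simp add: wedge_remove_nth)
  also have "\<dots> \<subseteq> {\<tau>. finite \<tau> \<and> \<tau> \<subseteq> \<sigma>}"
    using True by (auto dest: in_set_takeD in_set_dropD)
  finally show ?thesis .
\<comment> \<open>For an infinite set \<open>sorted_list_of_set\<close> is the empty list, so the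
  sum is empty.\<close>
qed (simp add: face_sum_def)

definition above :: "'v::linorder \<Rightarrow> ('v, 'f::comm_ring_1) chain \<Rightarrow> bool" where
  "above e c \<longleftrightarrow> (\<forall>\<sigma>\<in>Poly_Mapping.keys c. finite \<sigma> \<and> (\<forall>v\<in>\<sigma>. e < v))"

lemma sorted_list_of_set_insert_least:
  "finite \<sigma> \<Longrightarrow> \<forall>v\<in>\<sigma>. e < v \<Longrightarrow> sorted_list_of_set (insert e \<sigma>) = e # sorted_list_of_set \<sigma>"
  by (rule sorted_list_of_set_unique[THEN iffD1]) auto

text \<open>Deleting \<open>e\<close> from the first place gives back \<open>c\<close>. Every other
  deletion happens one place later than in \<open>c\<close>, whence the minus sign.\<close>

lemma boundary_prepend:
  fixes c :: "('v::linorder, 'f::comm_ring_1) chain"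
  assumes "above e c"
  shows "boundary (prepend e c) = c - prepend e (boundary c)"
proof (rule chain_linear_eqI[where c = c])
  show "chain_linear (\<lambda>c. boundary (prepend e c))" "chain_linear (\<lambda>c. c - prepend e (boundary c))"
    by (simp_all add: chain_linear_def boundary_simps prepend_simps scale_distribs)
next
  fix \<sigma> assume "\<sigma> \<in> Poly_Mapping.keys c"
  then have fin: "finite \<sigma>" and lt: "\<forall>v\<in>\<sigma>. e < v" using assms by (auto simp: above_def)
  let ?es = "sorted_list_of_set \<sigma>"
  have *: "(wedge (e # take i ?es @ drop (Suc i) ?es) :: ('v, 'f) chain) = prepend e (wedge (take i ?es @ drop (Suc i) ?es))"
    (is "?l = ?r") for i
  proof -
    have s: "sorted (take i ?es @ drop (Suc i) ?es)" "distinct (take i ?es @ drop (Suc i) ?es)"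
      using sorted_remove_nth[of ?es i] by auto
    have "sorted (e # take i ?es @ drop (Suc i) ?es)" "distinct (e # take i ?es @ drop (Suc i) ?es)"
      using s lt fin by (auto dest!: in_set_takeD in_set_dropD intro: less_imp_le)
    then have "?l = basis (set (e # take i ?es @ drop (Suc i) ?es))" by (rule wedge_sorted)
    then show ?thesis by (simp add: wedge_remove_nth prepend_def)
  qed
  have "boundary (prepend e (basis \<sigma>)) = (face_sum (insert e \<sigma>) :: ('v, 'f) chain)"
    by (simp add: boundary_eq_extend prepend_def)
  also have "\<dots> = wedge ?es + (\<Sum>i<length ?es. scale ((- 1) ^ Suc i) (wedge (e # take i ?es @ drop (Suc i) ?es)))"
    unfolding face_sum_def Let_def sorted_list_of_set_insert_least[OF fin lt] length_Cons
      sum.lessThan_Suc_shift by simp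
  also have "\<dots> = basis \<sigma> - prepend e (face_sum \<sigma>)"
    by (simp add: * face_sum_def Let_def wedge_sorted fin chain_linear_sum[OF prepend_linear]
        chain_linear_scale[OF prepend_linear] scale_minus_left sum_negf)
  finally show "boundary (prepend e (basis \<sigma>)) = (basis \<sigma> - prepend e (boundary (basis \<sigma>)) :: ('v, 'f) chain)"
    by (simp add: boundary_eq_extend)
qed

lemma join_eq_extend:
  "join c c' = extend (\<lambda>\<sigma>. extend (\<lambda>\<tau>. wedge (sorted_list_of_set \<sigma> @ sorted_list_of_set \<tau>)) c') c"
  by (simp add: join_def extend_def scale_sum)

lemma join_eq_prepend:
  fixes c :: "('v::linorder, 'f::comm_ring_1) chain"
  assumes "above e c"
  shows "join (wedge [e]) c = prepend e c"
proof -
  have "extend (\<lambda>\<tau>. wedge (e # sorted_list_of_set \<tau>)) c = prepend e c"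
  proof (rule chain_linear_eqI[where c = c and g = "prepend e"])
    fix \<sigma> assume "\<sigma> \<in> Poly_Mapping.keys c"
    then have fin: "finite \<sigma>" and lt: "\<forall>v\<in>\<sigma>. e < v" using assms by (auto simp: above_def)
    then have "wedge (e # sorted_list_of_set \<sigma>) =
        (basis (set (e # sorted_list_of_set \<sigma>)) :: ('v, 'f) chain)"
      by (intro wedge_sorted) auto
    then show "extend (\<lambda>\<tau>. wedge (e # sorted_list_of_set \<tau>)) (basis \<sigma>) =
        (prepend e (basis \<sigma>) :: ('v, 'f) chain)"
      using fin by (simp add: prepend_def)
  qed (rule extend_linear prepend_linear)+
  then show ?thesis by (simp add: join_eq_extend wedge_sorted)
qed

section \<open>Homology modules\<close>

lemma chain_module_sel [simp]:
  "zero (chain_module K d) = 0" "add (chain_module K d) = (+)" "smult (chain_module K d) = scale"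
  by (simp_all add: chain_module_def)

lemma in_chains:
  "c \<in> carrier (chain_module K d) \<longleftrightarrow>
    (\<forall>\<sigma>\<in>Poly_Mapping.keys c. \<sigma> \<in> K \<and> finite \<sigma> \<and> int (card \<sigma>) = d + 1)"
  by (simp add: chain_module_def)

lemma chains_closed:
  "0 \<in> carrier (chain_module K d)"
  "x \<in> carrier (chain_module K d) \<Longrightarrow> y \<in> carrier (chain_module K d) \<Longrightarrow> x + y \<in> carrier (chain_module K d)"
  "x \<in> carrier (chain_module K d) \<Longrightarrow> y \<in> carrier (chain_module K d) \<Longrightarrow> x - y \<in> carrier (chain_module K d)"
  "x \<in> carrier (chain_module K d) \<Longrightarrow> - x \<in> carrier (chain_module K d)"
  "x \<in> carrier (chain_module K d) \<Longrightarrow> scale r x \<in> carrier (chain_module K d)"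
  unfolding in_chains
  by (simp, meson UnE keys_add subsetD, meson UnE keys_diff subsetD, simp, meson keys_scale subsetD)

lemma chains_sum:
  "(\<And>i. i \<in> I \<Longrightarrow> x i \<in> carrier (chain_module K d)) \<Longrightarrow> (\<Sum>i\<in>I. x i) \<in> carrier (chain_module K d)"
  by (induction I rule: infinite_finite_induct) (auto intro: chains_closed)

lemma cycles_closed:
  "0 \<in> cycles K d"
  "x \<in> cycles K d \<Longrightarrow> y \<in> cycles K d \<Longrightarrow> x + y \<in> cycles K d"
  "x \<in> cycles K d \<Longrightarrow> y \<in> cycles K d \<Longrightarrow> x - y \<in> cycles K d"
  "x \<in> cycles K d \<Longrightarrow> - x \<in> cycles K d"
  "x \<in> cycles K d \<Longrightarrow> scale r x \<in> cycles K d"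
  by (auto simp: cycles_def boundary_simps chains_closed)

lemma cycles_sum: "(\<And>i. i \<in> I \<Longrightarrow> x i \<in> cycles K d) \<Longrightarrow> (\<Sum>i\<in>I. x i) \<in> cycles K d"
  by (induction I rule: infinite_finite_induct) (auto intro: cycles_closed)

lemma boundariesI: "c \<in> carrier (chain_module K (d + 1)) \<Longrightarrow> boundary c \<in> boundaries K d"
  by (simp add: boundaries_def)

lemma boundaries_closed:
  "0 \<in> boundaries K d"
  "x \<in> boundaries K d \<Longrightarrow> y \<in> boundaries K d \<Longrightarrow> x + y \<in> boundaries K d"
  "x \<in> boundaries K d \<Longrightarrow> y \<in> boundaries K d \<Longrightarrow> x - y \<in> boundaries K d"
  "x \<in> boundaries K d \<Longrightarrow> - x \<in> boundaries K d"
  "x \<in> boundaries K d \<Longrightarrow> scale r x \<in> boundaries K d"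
proof -
  show "0 \<in> boundaries K d"
    using boundariesI[OF chains_closed(1)] by (simp add: boundary_simps)
  show "x + y \<in> boundaries K d" "x - y \<in> boundaries K d"
    if xy: "x \<in> boundaries K d" "y \<in> boundaries K d"
  proof -
    obtain x' y' where "x = boundary x'" "y = boundary y'"
      "x' \<in> carrier (chain_module K (d + 1))" "y' \<in> carrier (chain_module K (d + 1))"
      using xy by (auto simp: boundaries_def)
    then show "x + y \<in> boundaries K d" "x - y \<in> boundaries K d"
      using boundariesI[of "x' + y'" K d] boundariesI[of "x' - y'" K d] chains_closed(2,3)[of x' K "d + 1" y']
      by (simp_all add: boundary_simps)
  qed
  show "- x \<in> boundaries K d" "scale r x \<in> boundaries K d" if x: "x \<in> boundaries K d"
  proof -
    obtain x' where "x = boundary x'" "x' \<in> carrier (chain_module K (d + 1))"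
      using x by (auto simp: boundaries_def)
    then show "- x \<in> boundaries K d" "scale r x \<in> boundaries K d"
      using boundariesI[of "- x'" K d] boundariesI[of "scale r x'" K d] chains_closed(4,5)[of x' K "d + 1"]
      by (simp_all add: boundary_simps)
  qed
qed

section \<open>Homology classes and the operations on them\<close>

definition homology_class ::
  "'v::linorder set set \<Rightarrow> int \<Rightarrow> ('v, 'f::comm_ring_1) chain \<Rightarrow> ('v, 'f) chain set" where
  "homology_class K d z = {b + z | b. b \<in> boundaries K d}"

lemma homology_class_eq_iff:
  "homology_class K d z = homology_class K d w \<longleftrightarrow> z - w \<in> boundaries K d"
proof
  assume "homology_class K d z = homology_class K d w"
  moreover have "0 + z \<in> homology_class K d z"
    unfolding homology_class_def using boundaries_closed(1) by blast
  ultimately obtain b where "z = b + w" "b \<in> boundaries K d"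
    by (auto simp: homology_class_def)
  then show "z - w \<in> boundaries K d" by simp
next
  assume *: "z - w \<in> boundaries K d"
  have "b + z = (b + (z - w)) + w" "b + w = (b - (z - w)) + z" for b by simp_all
  then show "homology_class K d z = homology_class K d w"
    unfolding homology_class_def using boundaries_closed(2,3)[OF _ *] by blast
qed

lemma reduced_homology_carrier:
  "carrier (reduced_homology K d) = homology_class K d ` cycles K d"
  by (auto simp: reduced_homology_def quotient_module_def A_RCOSETS_def RCOSETS_def r_coset_def
      homology_class_def)

lemma reduced_homology_zero: "\<zero>\<^bsub>reduced_homology K d\<^esub> = homology_class K d 0"
  by (auto simp: reduced_homology_def quotient_module_def homology_class_def)

lemma reduced_homology_add:
  "homology_class K d z \<oplus>\<^bsub>reduced_homology K d\<^esub> homology_class K d w = homology_class K d (z + w)"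
proof -
  have "(\<exists>b\<in>boundaries K d. \<exists>b'\<in>boundaries K d. x = (b + z) + (b' + w)) \<longleftrightarrow>
      (\<exists>b\<in>boundaries K d. x = b + (z + w))" for x
  proof
    assume "\<exists>b\<in>boundaries K d. \<exists>b'\<in>boundaries K d. x = (b + z) + (b' + w)"
    then obtain b b' where "b \<in> boundaries K d" "b' \<in> boundaries K d" "x = (b + b') + (z + w)"
      by (auto simp: algebra_simps)
    then show "\<exists>b\<in>boundaries K d. x = b + (z + w)" using boundaries_closed(2) by blast
  next
    assume "\<exists>b\<in>boundaries K d. x = b + (z + w)"
    then obtain b where "b \<in> boundaries K d" "x = (b + z) + (0 + w)" by (auto simp: add.assoc)
    then show "\<exists>b\<in>boundaries K d. \<exists>b'\<in>boundaries K d. x = (b + z) + (b' + w)"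
      using boundaries_closed(1) by blast
  qed
  moreover have "homology_class K d z \<oplus>\<^bsub>reduced_homology K d\<^esub> homology_class K d w =
      {x. \<exists>b\<in>boundaries K d. \<exists>b'\<in>boundaries K d. x = (b + z) + (b' + w)}"
    by (auto simp: reduced_homology_def quotient_module_def homology_class_def set_add_def set_mult_def)
  ultimately show ?thesis by (auto simp: homology_class_def)
qed

text \<open>The values of \<open>f\<close> on boundaries are absorbed by
  \<open>boundaries L e\<close>, so the set sum in \<open>induced_map\<close> collapses to one
  coset.\<close>

lemma coset_image:
  assumes f: "chain_linear f" "f ` boundaries K d \<subseteq> boundaries L e"
  shows "{b + f (b' + z) | b b'. b \<in> boundaries L e \<and> b' \<in> boundaries K d} = {b + f z | b. b \<in> boundaries L e}"
proof (intro equalityI subsetI)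
  fix x assume "x \<in> {b + f (b' + z) | b b'. b \<in> boundaries L e \<and> b' \<in> boundaries K d}"
  then obtain b b' where *: "b \<in> boundaries L e" "b' \<in> boundaries K d" and "x = b + f (b' + z)" by blast
  then have "x = (b + f b') + f z" by (simp add: chain_linear_add[OF f(1)] add.assoc)
  moreover have "b + f b' \<in> boundaries L e" using * f(2) boundaries_closed(2) by blast
  ultimately show "x \<in> {b + f z | b. b \<in> boundaries L e}" by blast
next
  fix x assume "x \<in> {b + f z | b. b \<in> boundaries L e}"
  then obtain b where "b \<in> boundaries L e" "x = b + f (0 + z)" by auto
  then show "x \<in> {b + f (b' + z) | b b'. b \<in> boundaries L e \<and> b' \<in> boundaries K d}"
    using boundaries_closed(1) by blast
qed

lemma induced_map_class:
  assumes "chain_linear f" "f ` boundaries K d \<subseteq> boundaries L e"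
  shows "induced_map f L e (homology_class K d z) = homology_class L e (f z)"
proof -
  have "induced_map f L e (homology_class K d z) =
      {b + f (b' + z) | b b'. b \<in> boundaries L e \<and> b' \<in> boundaries K d}"
    by (auto simp: induced_map_def homology_class_def set_add_def set_mult_def)
  then show ?thesis by (simp add: coset_image[OF assms] homology_class_def)
qed

text \<open>The pointwise multiple of a coset by a non-unit can be smaller than a coset, so the
  quotient adds the boundaries again. The result is the map induced by
  \<open>scale r\<close>.\<close>

lemma reduced_homology_smult:
  "r \<odot>\<^bsub>reduced_homology K d\<^esub> homology_class K d z = homology_class K d (scale r z)"
proof -
  have lin: "chain_linear (scale r :: ('a, 'b) chain \<Rightarrow> ('a, 'b) chain)"
    by (simp add: chain_linear_def scale_distribs mult.commute)
  have "r \<odot>\<^bsub>reduced_homology K d\<^esub> homology_class K d z = induced_map (scale r) K d (homology_class K d z)"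
    by (simp add: reduced_homology_def quotient_module_def induced_map_def set_add_def set_mult_def)
  also have "\<dots> = homology_class K d (scale r z)"
    by (intro induced_map_class lin) (auto intro: boundaries_closed)
  finally show ?thesis .
qed

lemmas reduced_homology_simps =
  reduced_homology_carrier reduced_homology_zero reduced_homology_add reduced_homology_smult

lemma coeff_ring_simps:
  "carrier coeff_ring = UNIV" "add coeff_ring = (+)" "monoid.mult coeff_ring = (*)" "one coeff_ring = 1"
  by (simp_all add: ring_of_type_algebra_def)

lemma reduced_homology_module: "module coeff_ring (reduced_homology K d)"
proof (rule moduleI)
  show "abelian_group (reduced_homology K d)"
  proof (rule abelian_groupI)
    fix x assume "x \<in> carrier (reduced_homology K d)"
    then obtain z where "z \<in> cycles K d" "x = homology_class K d z"
      by (auto simp: reduced_homology_simps)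
    then show "\<exists>y\<in>carrier (reduced_homology K d). y \<oplus>\<^bsub>reduced_homology K d\<^esub> x = \<zero>\<^bsub>reduced_homology K d\<^esub>"
      by (intro bexI[of _ "homology_class K d (- z)"])
        (auto simp: reduced_homology_simps cycles_closed)
  qed (auto simp: reduced_homology_simps cycles_closed algebra_simps)
qed (auto simp: reduced_homology_simps cycles_closed scale_distribs scale_add_left coeff_ring_simps
    cring_from_type_algebra)

lemma reduced_homology_abelian_monoid: "abelian_monoid (reduced_homology K d)"
  by (intro abelian_group.axioms(1) module.axioms(2)[OF reduced_homology_module])

lemma reduced_homology_finsum:
  assumes "finite I" "\<And>i. i \<in> I \<Longrightarrow> z i \<in> cycles K d"
  shows "(\<Oplus>\<^bsub>reduced_homology K d\<^esub>i\<in>I. homology_class K d (z i)) = homology_class K d (\<Sum>i\<in>I. z i)"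
  using assms
proof (induction I rule: finite_induct)
  case empty
  show ?case
    by (simp add: abelian_monoid.finsum_empty[OF reduced_homology_abelian_monoid] reduced_homology_zero)
next
  case (insert i I)
  have "(\<lambda>i. homology_class K d (z i)) \<in> I \<rightarrow> carrier (reduced_homology K d)"
    "homology_class K d (z i) \<in> carrier (reduced_homology K d)"
    using insert.prems by (auto simp: reduced_homology_carrier)
  then show ?case
    using insert
    by (simp add: abelian_monoid.finsum_insert[OF reduced_homology_abelian_monoid] reduced_homology_add)
qed

lemma induced_map_hom:
  assumes "chain_linear f" "f ` boundaries K d \<subseteq> boundaries L e" "f ` cycles K d \<subseteq> cycles L e"
  shows "induced_map f L e \<in> module_hom coeff_ring (reduced_homology K d) (reduced_homology L e)"
  using assms(3)
  by (auto simp: module_hom_def hom_def reduced_homology_simps coeff_ring_simps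
      induced_map_class[OF assms(1,2)] chain_linear_simps[OF assms(1)])

section \<open>Finite direct sums of modules\<close>

lemma direct_sum_carrier:
  assumes "finite I" "\<And>i. i \<in> I \<Longrightarrow> module R (M i)"
  shows "carrier (direct_sum I M) = (\<Pi>\<^sub>E i\<in>I. carrier (M i))"
proof -
  have "group (add_monoid (M i))" if "i \<in> I" for i
    using assms(2)[OF that] by (meson abelian_group.a_group module_def)
  then show ?thesis using assms(1) by (simp add: direct_sum_def carrier_sum_group)
qed

lemma direct_sum_sel:
  "\<zero>\<^bsub>direct_sum I M\<^esub> = (\<lambda>i\<in>I. \<zero>\<^bsub>M i\<^esub>)"
  "x \<oplus>\<^bsub>direct_sum I M\<^esub> y = (\<lambda>i\<in>I. x i \<oplus>\<^bsub>M i\<^esub> y i)"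
  "r \<odot>\<^bsub>direct_sum I M\<^esub> x = (\<lambda>i\<in>I. r \<odot>\<^bsub>M i\<^esub> x i)"
  by (simp_all add: direct_sum_def)

lemma direct_sum_module:
  assumes "cring R" "finite I" and M: "\<And>i. i \<in> I \<Longrightarrow> module R (M i)"
  shows "module R (direct_sum I M)"
proof -
  note carr = direct_sum_carrier[OF assms(2) M]
  have grp: "abelian_group (M i)" if "i \<in> I" for i
    using M[OF that] by (simp add: module_def)
  have mem: "i \<in> I \<Longrightarrow> x \<in> carrier (direct_sum I M) \<Longrightarrow> x i \<in> carrier (M i)" for x i
    by (auto simp: carr)
  \<comment> \<open>Members of the direct sum are extensional functions, so each module law reduces
    to its components.\<close>
  have ext: "x = y" if "x \<in> extensional I" "y \<in> extensional I" "\<And>i. i \<in> I \<Longrightarrow> x i = y i"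
    for x y :: "'c \<Rightarrow> 'd"
    using that by (rule extensionalityI)
  have carr_ext: "x \<in> carrier (direct_sum I M) \<Longrightarrow> x \<in> extensional I" for x
    by (auto simp: carr PiE_iff)
  note closed = abelian_groupE(1,2)[OF grp] module.smult_closed[OF M] abelian_group.a_inv_closed[OF grp]
  show ?thesis
  proof (rule moduleI)
    show "abelian_group (direct_sum I M)"
    proof (rule abelian_groupI)
      fix x assume x: "x \<in> carrier (direct_sum I M)"
      show "\<exists>y\<in>carrier (direct_sum I M). y \<oplus>\<^bsub>direct_sum I M\<^esub> x = \<zero>\<^bsub>direct_sum I M\<^esub>"
      proof
        show "(\<lambda>i\<in>I. \<ominus>\<^bsub>M i\<^esub> x i) \<in> carrier (direct_sum I M)"
          using mem[OF _ x] closed by (simp add: carr)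
        show "(\<lambda>i\<in>I. \<ominus>\<^bsub>M i\<^esub> x i) \<oplus>\<^bsub>direct_sum I M\<^esub> x = \<zero>\<^bsub>direct_sum I M\<^esub>"
          using mem[OF _ x] by (intro ext) (simp_all add: direct_sum_sel abelian_group.l_neg[OF grp])
      qed
      show "\<zero>\<^bsub>direct_sum I M\<^esub> \<oplus>\<^bsub>direct_sum I M\<^esub> x = x"
        using mem[OF _ x] carr_ext[OF x]
        by (intro ext) (simp_all add: direct_sum_sel abelian_groupE(5)[OF grp])
      fix y assume y: "y \<in> carrier (direct_sum I M)"
      show "x \<oplus>\<^bsub>direct_sum I M\<^esub> y \<in> carrier (direct_sum I M)"
        using mem[OF _ x] mem[OF _ y] closed by (simp add: carr direct_sum_sel)
      show "x \<oplus>\<^bsub>direct_sum I M\<^esub> y = y \<oplus>\<^bsub>direct_sum I M\<^esub> x"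
        using mem[OF _ x] mem[OF _ y]
        by (intro ext) (simp_all add: direct_sum_sel abelian_groupE(4)[OF grp])
      fix z assume z: "z \<in> carrier (direct_sum I M)"
      show "x \<oplus>\<^bsub>direct_sum I M\<^esub> y \<oplus>\<^bsub>direct_sum I M\<^esub> z
          = x \<oplus>\<^bsub>direct_sum I M\<^esub> (y \<oplus>\<^bsub>direct_sum I M\<^esub> z)"
        using mem[OF _ x] mem[OF _ y] mem[OF _ z]
        by (intro ext) (simp_all add: direct_sum_sel abelian_groupE(3)[OF grp])
    next
      show "\<zero>\<^bsub>direct_sum I M\<^esub> \<in> carrier (direct_sum I M)"
        using closed by (simp add: carr direct_sum_sel)
    qed
  next
    fix x assume x: "x \<in> carrier (direct_sum I M)"
    show "\<one>\<^bsub>R\<^esub> \<odot>\<^bsub>direct_sum I M\<^esub> x = x"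
      using mem[OF _ x] carr_ext[OF x]
      by (intro ext) (simp_all add: direct_sum_sel module.smult_one[OF M])
    fix a assume a: "a \<in> carrier R"
    show "a \<odot>\<^bsub>direct_sum I M\<^esub> x \<in> carrier (direct_sum I M)"
      using mem[OF _ x] a closed by (simp add: carr direct_sum_sel)
    show "a \<odot>\<^bsub>direct_sum I M\<^esub> (x \<oplus>\<^bsub>direct_sum I M\<^esub> y) =
        a \<odot>\<^bsub>direct_sum I M\<^esub> x \<oplus>\<^bsub>direct_sum I M\<^esub> a \<odot>\<^bsub>direct_sum I M\<^esub> y"
      if y: "y \<in> carrier (direct_sum I M)" for y
      using mem[OF _ x] mem[OF _ y] a
      by (intro ext) (simp_all add: direct_sum_sel module.smult_r_distr[OF M])
    fix b assume b: "b \<in> carrier R"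
    show "(a \<oplus>\<^bsub>R\<^esub> b) \<odot>\<^bsub>direct_sum I M\<^esub> x =
        a \<odot>\<^bsub>direct_sum I M\<^esub> x \<oplus>\<^bsub>direct_sum I M\<^esub> b \<odot>\<^bsub>direct_sum I M\<^esub> x"
      using mem[OF _ x] a b
      by (intro ext) (simp_all add: direct_sum_sel module.smult_l_distr[OF M])
    show "(a \<otimes>\<^bsub>R\<^esub> b) \<odot>\<^bsub>direct_sum I M\<^esub> x =
        a \<odot>\<^bsub>direct_sum I M\<^esub> (b \<odot>\<^bsub>direct_sum I M\<^esub> x)"
      using mem[OF _ x] a b
      by (intro ext) (simp_all add: direct_sum_sel module.smult_assoc1[OF M])
  qed (rule assms(1))
qed

section \<open>Splitting chains along the vertices 1 and 2\<close>

declare One_nat_def [simp del]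

text \<open>The identities between the cone maps see of a tail only its rows; its columns enter when
  supports are computed.\<close>

definition tail :: "(edge, 'f::comm_ring_1) chain \<Rightarrow> bool" where
  "tail w \<longleftrightarrow> (\<forall>\<sigma>\<in>Poly_Mapping.keys w. finite \<sigma> \<and> (\<forall>v\<in>\<sigma>. 3 \<le> fst v))"

text \<open>
  Edges at the vertices 1 and 2 precede all others, so the terms of \<open>c\<close> whose edges at 1 and 2 form
  the set \<open>A\<close> add up to \<open>wedge A \<and> head_part A c\<close> with the vertices of \<open>A\<close> in increasing order.
\<close>

definition head_part :: "edge set \<Rightarrow> (edge, 'f::comm_ring_1) chain \<Rightarrow> (edge, 'f) chain" where
  "head_part A = extend (\<lambda>\<sigma>. if {v \<in> \<sigma>. fst v \<le> 2} = A then basis (\<sigma> - A) else 0)"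

lemma head_part_linear: "chain_linear (head_part A)"
  unfolding head_part_def by (rule extend_linear)

lemmas head_part_simps = chain_linear_simps[OF head_part_linear]

lemma tail_boundary:
  assumes "tail w"
  shows "tail (boundary w)"
  unfolding tail_def
proof
  fix \<sigma> assume "\<sigma> \<in> Poly_Mapping.keys (boundary w)"
  then obtain \<tau> where \<tau>: "\<tau> \<in> Poly_Mapping.keys w" "\<sigma> \<in> Poly_Mapping.keys (face_sum \<tau> :: (edge, 'a) chain)"
    using keys_extend[of face_sum w] unfolding boundary_eq_extend by auto
  then have "finite \<sigma> \<and> \<sigma> \<subseteq> \<tau>" using keys_face_sum[of \<tau>] by auto
  then show "finite \<sigma> \<and> (\<forall>v\<in>\<sigma>. 3 \<le> fst v)"
    using \<tau>(1) assms by (auto simp: tail_def)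
qed

lemma less_edgeI: "fst (e :: edge) < fst v \<Longrightarrow> e < v"
  by (simp add: less_prod_def')

lemma above_tail:
  assumes "tail w" "fst e \<le> 2"
  shows "above e w"
  unfolding above_def
proof (intro ballI conjI less_edgeI)
  fix \<sigma> assume \<sigma>: "\<sigma> \<in> Poly_Mapping.keys w"
  then show "finite \<sigma>" using assms by (simp add: tail_def)
  fix v assume "v \<in> \<sigma>"
  then have "3 \<le> fst v" using assms \<sigma> by (simp add: tail_def)
  then show "fst e < fst v" using assms by simp
qed

lemma keys_prepend: "Poly_Mapping.keys (prepend e w) \<subseteq> insert e ` Poly_Mapping.keys w"
  unfolding prepend_def using keys_extend[of "\<lambda>\<sigma>. basis (insert e \<sigma>)" w] by (auto split: if_splits)

lemma above_prepend_tail: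
  assumes "tail w"
  shows "above (1, s) (prepend (2, t) w)"
  unfolding above_def
proof (intro ballI conjI less_edgeI)
  fix \<sigma> assume "\<sigma> \<in> Poly_Mapping.keys (prepend (2, t) w)"
  then obtain \<tau> where \<tau>: "\<tau> \<in> Poly_Mapping.keys w" "\<sigma> = insert (2, t) \<tau>"
    using subsetD[OF keys_prepend] by (metis imageE)
  then show "finite \<sigma>" using assms by (simp add: tail_def)
  fix v assume "v \<in> \<sigma>"
  then have "2 \<le> fst v" using \<tau> assms by (force simp: tail_def)
  then show "fst (1, s) < fst v" by simp
qed

text \<open>With two head edges, deleting the second passes the first and is negative, while
  deletions in \<open>w\<close> pass both and keep their sign.\<close>

lemma boundary_prepend_tail:
  assumes "tail w"
  shows "fst e \<le> 2 \<Longrightarrow> boundary (prepend e w) = w - prepend e (boundary w)"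
    and "boundary (prepend (1, s) (prepend (2, t) w)) =
      prepend (2, t) w - prepend (1, s) w + prepend (1, s) (prepend (2, t) (boundary w))"
proof -
  show *: "boundary (prepend e w) = w - prepend e (boundary w)" if "fst e \<le> 2" for e
    using that assms by (intro boundary_prepend above_tail)
  show "boundary (prepend (1, s) (prepend (2, t) w)) =
      prepend (2, t) w - prepend (1, s) w + prepend (1, s) (prepend (2, t) (boundary w))"
    by (simp add: boundary_prepend[OF above_prepend_tail[OF assms]] * prepend_simps)
qed

lemma head_part_tail:
  assumes "tail w"
  shows "head_part A w = (if A = {} then w else 0)"
    and "fst e \<le> 2 \<Longrightarrow> head_part A (prepend e w) = (if A = {e} then w else 0)"
    and "head_part A (prepend (1, s) (prepend (2, t) w)) = (if A = {(1, s), (2, t)} then w else 0)"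
proof -
  have tails: "{v \<in> \<sigma>. fst v \<le> 2} = {}" if "\<sigma> \<in> Poly_Mapping.keys w" for \<sigma>
    using assms that by (fastforce simp: tail_def)
  show "head_part A w = (if A = {} then w else 0)"
  proof (rule chain_linear_eqI[where c = w and f = "head_part A"])
    fix \<sigma> assume "\<sigma> \<in> Poly_Mapping.keys w"
    then show "head_part A (basis \<sigma>) = (if A = {} then basis \<sigma> else 0 :: (edge, 'a) chain)"
      by (simp add: head_part_def tails)
  qed (rule head_part_linear, simp add: chain_linear_def)
  show "head_part A (prepend e w) = (if A = {e} then w else 0)" if e: "fst e \<le> 2"
  proof (rule chain_linear_eqI[where c = w])
    fix \<sigma> assume \<sigma>: "\<sigma> \<in> Poly_Mapping.keys w"
    have "{v \<in> insert e \<sigma>. fst v \<le> 2} = {e}" "insert e \<sigma> - {e} = \<sigma>"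
      using tails[OF \<sigma>] e by auto
    then show "head_part A (prepend e (basis \<sigma>)) = (if A = {e} then basis \<sigma> else 0 :: (edge, 'a) chain)"
      by (auto simp: head_part_def prepend_def)
  qed (auto simp: chain_linear_def head_part_simps prepend_simps)
  show "head_part A (prepend (1, s) (prepend (2, t) w)) = (if A = {(1, s), (2, t)} then w else 0)"
  proof (rule chain_linear_eqI[where c = w])
    fix \<sigma> assume \<sigma>: "\<sigma> \<in> Poly_Mapping.keys w"
    have "{v \<in> insert (1, s) (insert (2, t) \<sigma>). fst v \<le> 2} = {(1, s), (2, t)}"
      "insert (1, s) (insert (2, t) \<sigma>) - {(1, s), (2, t)} = \<sigma>"
      using tails[OF \<sigma>] by auto
    then show "head_part A (prepend (1, s) (prepend (2, t) (basis \<sigma>))) =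
        (if A = {(1, s), (2, t)} then basis \<sigma> else 0 :: (edge, 'a) chain)"
      by (auto simp: head_part_def prepend_def)
  qed (auto simp: chain_linear_def head_part_simps prepend_simps)
qed

text \<open>
  The subtracted sum makes \<open>Q_part\<close> compatible with the boundary: it cancels the terms \<open>(1,s) \<and> (2,1)\<close>
  of a chain, and the boundary of a term \<open>(1,s) \<and> (2,t)\<close> then contributes exactly \<open>R_part (s,t)\<close>.
\<close>

definition Q_part :: "nat \<Rightarrow> (edge, 'f::comm_ring_1) chain \<Rightarrow> (edge, 'f) chain" where
  "Q_part n c = - head_part {(2, 1)} c - (\<Sum>s\<in>{2..n}. head_part {(1, s)} c)"

definition R_part :: "nat \<times> nat \<Rightarrow> (edge, 'f::comm_ring_1) chain \<Rightarrow> (edge, 'f) chain" where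
  "R_part p c = head_part {(1, fst p), (2, snd p)} c"

text \<open>
  The last term is \<open>(2,1) \<and> (1,s) \<and> y\<close>, with the sign of the transposition. The two correction terms
  join \<open>(2,t)\<close> to \<open>(1,1)\<close> and \<open>(1,s)\<close> to \<open>(2,1)\<close>, so that a cycle \<open>y\<close> gives a chain with boundary
  exactly \<open>iota y\<close>.
\<close>

definition kappa :: "nat \<times> nat \<Rightarrow> (edge, 'f::comm_ring_1) chain \<Rightarrow> (edge, 'f) chain" where
  "kappa p y = prepend (1, fst p) (prepend (2, snd p) y) - prepend (1, 1) (prepend (2, snd p) y)
     - prepend (1, fst p) (prepend (2, 1) y)"

text \<open>The acyclic matching behind the collapse: for \<open>s, t \<ge> 2\<close>,
  \<open>(1,1)\<close> is added to \<tau> and to \<open>(2,t) \<union> \<tau>\<close>, and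
  \<open>(2,1)\<close> to \<open>(1,s) \<union> \<tau>\<close>. The last sum is negative because
  \<open>(2,1)\<close> takes the second place, where its deletion has sign -1. Faces with any other
  head are sent to 0.\<close>

definition contraction :: "nat \<Rightarrow> (edge, 'f::comm_ring_1) chain \<Rightarrow> (edge, 'f) chain" where
  "contraction n c = prepend (1, 1) (head_part {} c)
     + (\<Sum>t\<in>{2..n}. prepend (1, 1) (prepend (2, t) (head_part {(2, t)} c)))
     - (\<Sum>s\<in>{2..n}. prepend (1, s) (prepend (2, 1) (head_part {(1, s)} c)))"

lemma part_linear:
  "chain_linear (Q_part n)" "chain_linear (R_part p)" "chain_linear (kappa p)" "chain_linear (contraction n)"
proof -
  show "chain_linear (Q_part n)"
    unfolding Q_part_def[abs_def] by (intro chain_linear_intros head_part_linear)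
  show "chain_linear (R_part p)"
    unfolding R_part_def[abs_def] by (rule head_part_linear)
  show "chain_linear (kappa p)"
    unfolding kappa_def[abs_def] by (intro chain_linear_intros)
  show "chain_linear (contraction n)"
    unfolding contraction_def[abs_def] by (intro chain_linear_intros head_part_linear)
qed

lemma iota_linear: "chain_linear (iota :: (edge, 'f::comm_ring_1) chain \<Rightarrow> (edge, 'f) chain)"
proof -
  \<comment> \<open>\<open>join\<close> has the sum over its left factor outside; exchanging the two
    sums exhibits \<open>iota\<close> as an extension in the right factor.\<close>
  have *: "iota w = extend (\<lambda>\<tau>. extend (\<lambda>\<sigma>. wedge (sorted_list_of_set \<sigma> @ sorted_list_of_set \<tau>))
      (wedge [(1, 1)] - wedge [(2, 1)])) w" for w :: "(edge, 'f) chain"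
    by (simp add: iota_def join_def extend_def scale_sum mult.commute, rule sum.swap)
  show ?thesis by (simp add: chain_linear_def * chain_linear_simps[OF extend_linear])
qed

lemma iota_tail: "tail w \<Longrightarrow> iota w = prepend (1, 1) w - prepend (2, 1) w"
proof -
  assume "tail w"
  have "iota w = join (wedge [(1, 1)]) w - join (wedge [(2, 1)]) w"
    by (simp add: iota_def join_eq_extend chain_linear_diff[OF extend_linear])
  then show ?thesis using \<open>tail w\<close> by (simp add: join_eq_prepend above_tail)
qed

section \<open>The cone identities, checked on basis chains\<close>

lemma finite_R_index: "finite (R_index n)"
  by (rule finite_subset[of _ "{2..n} \<times> {2..n}"]) (auto simp: R_index_def)

text \<open>The row numbers tell the two edges apart, so an unordered head determines the ordered
  pair of columns.\<close>

lemma heads_eq_iff: "{(1::nat, a), (2::nat, b)} = {(1, s), (2, t)} \<longleftrightarrow> a = s \<and> b = t"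
  by (simp add: doubleton_eq_iff)

lemma prepend_if: "prepend e (if P then w else 0) = (if P then prepend e w else 0)"
  by (simp add: prepend_simps)

text \<open>A matching has at most one edge in each of the rows 1 and 2, so there are four shapes of
  head. The tail is returned as a chain so that the rules for \<open>prepend\<close> and
  \<open>head_part\<close> apply to it directly; \<open>s \<noteq> t\<close> is the matching
  condition on columns.\<close>

lemma Gamma_basis_cases:
  assumes "\<sigma> \<in> Gamma_complex m n"
  obtains (none) w :: "(edge, 'f::comm_ring_1) chain" where "tail w" "basis \<sigma> = w"
  | (one) s and w :: "(edge, 'f::comm_ring_1) chain" where "tail w" "s \<in> {1..n}" "basis \<sigma> = prepend (1, s) w"
  | (two) t and w :: "(edge, 'f::comm_ring_1) chain" where "tail w" "t \<in> {1..n}" "basis \<sigma> = prepend (2, t) w"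
  | (both) s t and w :: "(edge, 'f::comm_ring_1) chain" where "tail w" "s \<in> {1..n}" "t \<in> {1..n}" "s \<noteq> t"
      "basis \<sigma> = prepend (1, s) (prepend (2, t) w)"
proof -
  define w :: "(edge, 'f::comm_ring_1) chain" where "w = basis {v \<in> \<sigma>. 3 \<le> fst v}"
  from assms have sub: "\<sigma> \<subseteq> {1..m} \<times> {1..n}"
    and inj: "\<And>e e'. e \<in> \<sigma> \<Longrightarrow> e' \<in> \<sigma> \<Longrightarrow> e \<noteq> e' \<Longrightarrow> fst e \<noteq> fst e' \<and> snd e \<noteq> snd e'"
    by (auto simp: Gamma_complex_def matching_complex_def)
  have "finite \<sigma>" using sub by (rule finite_subset) simp
  then have w: "tail w" by (simp add: w_def tail_def)
  have heads: "fst v = 1 \<or> fst v = 2 \<or> 3 \<le> fst v" if "v \<in> \<sigma>" for v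
    using sub that by fastforce
  have uniq: "v = e" if "v \<in> \<sigma>" "e \<in> \<sigma>" "fst v = fst e" for v e
    using inj[OF that(1,2)] that(3) by blast
  have rng: "j \<in> {1..n}" if "(i, j) \<in> \<sigma>" for i j
    using sub that by auto
  show thesis
  proof (cases "\<exists>s. (1, s) \<in> \<sigma>"; cases "\<exists>t. (2, t) \<in> \<sigma>")
    assume "\<exists>s. (1, s) \<in> \<sigma>" "\<exists>t. (2, t) \<in> \<sigma>"
    then obtain s t where st: "(1, s) \<in> \<sigma>" "(2, t) \<in> \<sigma>" by blast
    have "\<sigma> = insert (1, s) (insert (2, t) {v \<in> \<sigma>. 3 \<le> fst v})"
    proof -
      have "v \<in> \<sigma> \<longleftrightarrow> v = (1, s) \<or> v = (2, t) \<or> (v \<in> \<sigma> \<and> 3 \<le> fst v)" for v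
        using heads[of v] uniq[of v "(1, s)"] uniq[of v "(2, t)"] st by auto
      then show ?thesis by blast
    qed
    then have "basis \<sigma> = prepend (1, s) (prepend (2, t) w)"
      by (simp add: w_def prepend_def)
    then show thesis using both[of w s t] w rng[OF st(1)] rng[OF st(2)] inj[OF st] by simp
  next
    assume "\<exists>s. (1, s) \<in> \<sigma>" and no: "\<not> (\<exists>t. (2, t) \<in> \<sigma>)"
    then obtain s where st: "(1, s) \<in> \<sigma>" by blast
    have "\<sigma> = insert (1, s) {v \<in> \<sigma>. 3 \<le> fst v}"
    proof -
      have "v \<in> \<sigma> \<longleftrightarrow> v = (1, s) \<or> (v \<in> \<sigma> \<and> 3 \<le> fst v)" for v
        using heads[of v] uniq[of v "(1, s)"] st no by (cases v) auto
      then show ?thesis by blast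
    qed
    then have "basis \<sigma> = prepend (1, s) w"
      by (simp add: w_def prepend_def)
    then show thesis using one[of w s] w rng[OF st] by simp
  next
    assume no: "\<not> (\<exists>s. (1, s) \<in> \<sigma>)" and "\<exists>t. (2, t) \<in> \<sigma>"
    then obtain t where st: "(2, t) \<in> \<sigma>" by blast
    have "\<sigma> = insert (2, t) {v \<in> \<sigma>. 3 \<le> fst v}"
    proof -
      have "v \<in> \<sigma> \<longleftrightarrow> v = (2, t) \<or> (v \<in> \<sigma> \<and> 3 \<le> fst v)" for v
        using heads[of v] uniq[of v "(2, t)"] st no by (cases v) auto
      then show ?thesis by blast
    qed
    then have "basis \<sigma> = prepend (2, t) w"
      by (simp add: w_def prepend_def)
    then show thesis using two[of w t] w rng[OF st] by simp
  next
    assume no: "\<not> (\<exists>s. (1, s) \<in> \<sigma>)" "\<not> (\<exists>t. (2, t) \<in> \<sigma>)"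
    have "\<sigma> = {v \<in> \<sigma>. 3 \<le> fst v}" using heads no by (auto) (metis prod.collapse)
    then show thesis using none w by (simp add: w_def)
  qed
qed

lemmas iota_simps = chain_linear_simps[OF iota_linear]

lemmas part_simps = head_part_tail boundary_prepend_tail head_part_simps prepend_simps boundary_simps
  heads_eq_iff prepend_if tail_boundary

text \<open>The condition has the shape that \<open>heads_eq_iff\<close> produces when
  \<open>R_part p\<close> meets a two-edge head.\<close>

lemma sum_R_index_delta:
  "(\<Sum>p\<in>R_index n. if fst p = s \<and> snd p = t then f p else (0::'b::comm_monoid_add)) =
    (if s \<in> {2..n} \<and> t \<in> {2..n} \<and> s \<noteq> t then f (s, t) else 0)"
proof -
  have "(\<Sum>p\<in>R_index n. if fst p = s \<and> snd p = t then f p else 0) =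
      (\<Sum>p\<in>R_index n. if p = (s, t) then f p else 0)"
    by (intro sum.cong) auto
  also have "\<dots> = (if (s, t) \<in> R_index n then f (s, t) else 0)"
    using finite_R_index by (rule sum.delta)
  finally show ?thesis by (simp add: R_index_def)
qed

text \<open>Deleting a head edge leaves at most one, so \<open>R_part\<close> sees only deletions in
  the tail; these pass two edges and keep their sign.\<close>

lemma R_part_boundary_basis:
  assumes "\<sigma> \<in> Gamma_complex m n"
  shows "R_part p (boundary (basis \<sigma>)) = boundary (R_part p (basis \<sigma>) :: (edge, 'f::comm_ring_1) chain)"
  using assms
  by (cases rule: Gamma_basis_cases[where 'f = 'f]) (simp_all add: R_part_def part_simps)

text \<open>For a head \<open>(1,s), (2,t)\<close> the head deletions contribute \<open>w\<close> if
  \<open>s \<ge> 2\<close> and \<open>- w\<close> if \<open>t = 1\<close>. They cancel for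
  \<open>t = 1\<close>, both are absent for \<open>s = 1\<close>, and \<open>w\<close> remains
  exactly when the pair lies in \<open>R_index n\<close>. The minus before the last boundary comes
  from passing a single head edge.\<close>

lemma Q_part_boundary_basis:
  assumes "\<sigma> \<in> Gamma_complex m n"
  shows "Q_part n (boundary (basis \<sigma>)) =
      (\<Sum>p\<in>R_index n. R_part p (basis \<sigma>)) - boundary (Q_part n (basis \<sigma>) :: (edge, 'f::comm_ring_1) chain)"
  using assms
proof (cases rule: Gamma_basis_cases[where 'f = 'f])
  case (one s w)
  then show ?thesis by (simp add: R_part_def Q_part_def part_simps sum_negf sum.delta)
next
  case both
  then show ?thesis by (auto simp: R_part_def Q_part_def part_simps sum_R_index_delta sum_negf)
qed (simp_all add: R_part_def Q_part_def part_simps)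

lemma contraction_basis:
  assumes "\<sigma> \<in> Gamma_complex m n"
  shows "basis \<sigma> - iota (Q_part n (basis \<sigma>)) - (\<Sum>p\<in>R_index n. kappa p (R_part p (basis \<sigma>))) =
      boundary (contraction n (basis \<sigma>)) + (contraction n (boundary (basis \<sigma>)) :: (edge, 'f::comm_ring_1) chain)"
  using assms
proof (cases rule: Gamma_basis_cases[where 'f = 'f])
  case none
  then show ?thesis
    by (simp add: R_part_def Q_part_def kappa_def contraction_def part_simps iota_simps)
next
  case (one s w)
  then show ?thesis
    by (cases "s = 1") (simp_all add: sum_negf R_part_def Q_part_def kappa_def contraction_def part_simps iota_simps iota_tail)
next
  case (two t w)
  then show ?thesis
    by (cases "t = 1") (simp_all add: sum_negf R_part_def Q_part_def kappa_def contraction_def part_simps iota_simps iota_tail)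
next
  case (both s t w)
  have "kappa p (R_part p (basis \<sigma>)) = (if fst p = s \<and> snd p = t then kappa p w else 0)" for p
    using both by (auto simp: R_part_def part_simps chain_linear_zero[OF part_linear(3)])
  then have *: "(\<Sum>p\<in>R_index n. kappa p (R_part p (basis \<sigma>))) =
      (if s \<in> {2..n} \<and> t \<in> {2..n} \<and> s \<noteq> t then kappa (s, t) w else 0)"
    by (simp only: sum_R_index_delta)
  \<comment> \<open>A two-edge head is never extended, so only \<open>contraction\<close> of the
    boundary remains. It yields the heads \<open>(1,1), (2,t)\<close> and
    \<open>(1,s), (2,1)\<close>, the negatives of the correction terms of \<open>kappa\<close>. If
    \<open>s\<close> or \<open>t\<close> is 1, only one of them survives, and it is the face
    itself.\<close>
  have "Q_part n (basis \<sigma>) = (0 :: (edge, 'f) chain)" "contraction n (basis \<sigma>) = (0 :: (edge, 'f) chain)"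
    using both by (simp_all add: Q_part_def contraction_def part_simps)
  moreover have "boundary (basis \<sigma>) =
      prepend (2, t) w - prepend (1, s) w + prepend (1, s) (prepend (2, t) (boundary w))"
    using both by (simp add: boundary_prepend_tail)
  moreover have "contraction n (prepend (1, s) (prepend (2, t) (boundary w))) = 0"
    using both by (simp add: contraction_def part_simps)
  moreover have "contraction n (prepend (2, t) w) = (if t = 1 then 0 else prepend (1, 1) (prepend (2, t) w))"
    "contraction n (prepend (1, s) w) = (if s = 1 then 0 else - prepend (1, s) (prepend (2, 1) w))"
    using both by (auto simp: contraction_def part_simps)
  ultimately show ?thesis
    unfolding * using both
    by (auto simp: kappa_def chain_linear_simps[OF part_linear(4)] boundary_simps iota_simps)
qed

lemma chain_linear_comp: "chain_linear g \<Longrightarrow> chain_linear f \<Longrightarrow> chain_linear (\<lambda>c. g (f c))"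
  by (simp add: chain_linear_def)

abbreviation Gamma_chains :: "nat \<Rightarrow> nat \<Rightarrow> int \<Rightarrow> (edge, 'f::comm_ring_1) chain set" where
  "Gamma_chains m n d \<equiv> carrier (chain_module (Gamma_complex m n) d)"

lemma
  assumes c: "c \<in> Gamma_chains m n d"
  shows R_part_boundary: "R_part p (boundary c) = boundary (R_part p c)"
    and Q_part_boundary:
      "Q_part n (boundary c) = (\<Sum>p\<in>R_index n. R_part p c) - boundary (Q_part n c)"
    and contraction_homotopy:
      "c - iota (Q_part n c) - (\<Sum>p\<in>R_index n. kappa p (R_part p c)) =
        boundary (contraction n c) + contraction n (boundary c)"
proof -
  note comp = chain_linear_comp[OF part_linear(1) boundary_linear] chain_linear_comp[OF part_linear(2) boundary_linear]
    chain_linear_comp[OF part_linear(4) boundary_linear] chain_linear_comp[OF part_linear(3) part_linear(2)]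
    chain_linear_comp[OF iota_linear part_linear(1)]
  have \<sigma>: "\<sigma> \<in> Gamma_complex m n" if "\<sigma> \<in> Poly_Mapping.keys c" for \<sigma>
    using c that by (simp add: in_chains)
  show "R_part p (boundary c) = boundary (R_part p c)"
    by (rule chain_linear_eqI[where c = c])
      (intro comp chain_linear_intros part_linear, intro chain_linear_intros part_linear,
        rule R_part_boundary_basis[OF \<sigma>])
  show "Q_part n (boundary c) = (\<Sum>p\<in>R_index n. R_part p c) - boundary (Q_part n c)"
    by (rule chain_linear_eqI[where c = c])
      (intro comp, intro chain_linear_intros part_linear, rule Q_part_boundary_basis[OF \<sigma>])
  show "c - iota (Q_part n c) - (\<Sum>p\<in>R_index n. kappa p (R_part p c)) =
        boundary (contraction n c) + contraction n (boundary c)"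
    by (rule chain_linear_eqI[where c = c])
      (intro chain_linear_intros comp, intro chain_linear_intros comp part_linear,
        rule contraction_basis[OF \<sigma>])
qed

lemma boundary_iota: "tail w \<Longrightarrow> boundary (iota w) = - iota (boundary w)"
  by (simp add: iota_tail tail_boundary boundary_simps boundary_prepend_tail(1))

text \<open>Together with \<open>boundary_iota\<close> this makes \<open>iota\<close> and
  \<open>kappa\<close> a chain map out of the cone: the term \<open>iota y\<close> is the
  \<phi>-part of the cone differential.\<close>

lemma boundary_kappa: "tail y \<Longrightarrow> boundary (kappa p y) = iota y + kappa p (boundary y)"
  by (simp add: kappa_def iota_tail boundary_simps boundary_prepend_tail)

lemma Q_part_iota: "tail w \<Longrightarrow> Q_part n (iota w) = w"
  by (simp add: Q_part_def iota_tail part_simps)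

lemma R_part_iota: "tail w \<Longrightarrow> R_part p (iota w) = 0"
  by (simp add: R_part_def iota_tail part_simps)

text \<open>The correction terms of \<open>kappa\<close> have an edge in column 1, which does not
  occur in \<open>R_index n\<close>, so only the leading term is seen.\<close>

lemma R_part_kappa:
  assumes "tail y" "p \<in> R_index n" "q \<in> R_index n"
  shows "R_part q (kappa p y) = (if q = p then y else 0)"
  using assms
  by (cases p; cases q) (auto simp: R_part_def kappa_def part_simps R_index_def)

section \<open>Supports and degrees of the cone maps\<close>

definition R_complex :: "nat \<Rightarrow> nat \<Rightarrow> nat \<times> nat \<Rightarrow> edge set set" where
  "R_complex m n p = matching_complex {3..m} ({2..n} - {fst p, snd p})"

lemma tail_chains: "w \<in> carrier (chain_module (matching_complex {3..m} T) d) \<Longrightarrow> tail w"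
  by (fastforce simp: in_chains tail_def matching_complex_def)

lemma chains_mono:
  "w \<in> carrier (chain_module K d) \<Longrightarrow> K \<subseteq> L \<Longrightarrow> w \<in> carrier (chain_module L d)"
  by (auto simp: in_chains)

lemma matching_complex_mono: "T \<subseteq> T' \<Longrightarrow> matching_complex S T \<subseteq> matching_complex S T'"
  unfolding matching_complex_def by auto

lemma prepend_chains:
  assumes "w \<in> carrier (chain_module K d)" "\<And>\<sigma>. \<sigma> \<in> K \<Longrightarrow> e \<notin> \<sigma> \<and> insert e \<sigma> \<in> L"
  shows "prepend e w \<in> carrier (chain_module L (d + 1))"
  unfolding in_chains
proof
  fix \<sigma> assume "\<sigma> \<in> Poly_Mapping.keys (prepend e w)"
  then obtain \<tau> where "\<tau> \<in> Poly_Mapping.keys w" "\<sigma> = insert e \<tau>"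
    using subsetD[OF keys_prepend] by (metis imageE)
  then show "\<sigma> \<in> L \<and> finite \<sigma> \<and> int (card \<sigma>) = d + 1 + 1"
    using assms by (simp add: in_chains)
qed

text \<open>The edges left after removing \<open>A\<close> are in rows from 3 on, so \<Gamma> keeps
  them out of column 1, and the matching condition keeps them out of the columns of
  \<open>A\<close>. The degree drops by one for each edge removed.\<close>

lemma head_part_chains:
  fixes c :: "(edge, 'f::comm_ring_1) chain"
  assumes c: "c \<in> Gamma_chains m n d" and A: "finite A"
  shows "head_part A c \<in> carrier (chain_module (matching_complex {3..m} ({2..n} - snd ` A)) (d - card A))"
  unfolding in_chains
proof
  fix \<tau> assume "\<tau> \<in> Poly_Mapping.keys (head_part A c)"
  then obtain \<sigma> where \<sigma>: "\<sigma> \<in> Poly_Mapping.keys c"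
    and \<tau>: "\<tau> \<in> Poly_Mapping.keys (if {v \<in> \<sigma>. fst v \<le> 2} = A then basis (\<sigma> - A) else (0 :: (edge, 'f) chain))"
    using subsetD[OF keys_extend] unfolding head_part_def by (metis (no_types, lifting) UN_E)
  then have A_eq: "{v \<in> \<sigma>. fst v \<le> 2} = A" and \<tau>: "\<tau> = \<sigma> - A"
    by (auto split: if_splits)
  have \<sigma>K: "\<sigma> \<in> Gamma_complex m n" "finite \<sigma>" "int (card \<sigma>) = d + 1"
    using c \<sigma> by (auto simp: in_chains)
  then have sub: "\<sigma> \<subseteq> {1..m} \<times> {1..n}"
    and inj: "\<And>e e'. e \<in> \<sigma> \<Longrightarrow> e' \<in> \<sigma> \<Longrightarrow> e \<noteq> e' \<Longrightarrow> fst e \<noteq> fst e' \<and> snd e \<noteq> snd e'"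
    and no1: "\<And>s. 3 \<le> s \<Longrightarrow> s \<le> m \<Longrightarrow> (s, 1) \<notin> \<sigma>"
    by (auto simp: Gamma_complex_def matching_complex_def)
  have "A \<subseteq> \<sigma>" using A_eq by blast
  have "v \<in> {3..m} \<times> ({2..n} - snd ` A)" if v: "v \<in> \<tau>" for v
  proof -
    have v': "v \<in> \<sigma>" "v \<notin> A" using v \<tau> by auto
    then have "3 \<le> fst v" using A_eq by auto
    moreover have "fst v \<le> m" "1 \<le> snd v" "snd v \<le> n" using sub v' by auto
    moreover have "snd v \<noteq> 1" using no1[of "fst v"] v' calculation by (metis prod.collapse)
    moreover have "snd v \<notin> snd ` A" using inj[OF v'(1)] v' \<open>A \<subseteq> \<sigma>\<close> by blast
    ultimately show ?thesis by (cases v) auto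
  qed
  then have "\<tau> \<in> matching_complex {3..m} ({2..n} - snd ` A)"
    using inj unfolding matching_complex_def \<tau> by blast
  moreover have "int (card \<tau>) = d - int (card A) + 1"
    using \<sigma>K \<open>A \<subseteq> \<sigma>\<close> A unfolding \<tau> by (simp add: card_Diff_subset card_mono of_nat_diff)
  ultimately show "\<tau> \<in> matching_complex {3..m} ({2..n} - snd ` A) \<and> finite \<tau> \<and>
      int (card \<tau>) = d - int (card A) + 1"
    using \<sigma>K \<tau> by simp
qed

lemma matching_complex_insert:
  assumes "\<tau> \<in> matching_complex S T" "i \<notin> S" "j \<notin> T"
  shows "insert (i, j) \<tau> \<in> matching_complex (insert i S) (insert j T)" "(i, j) \<notin> \<tau>"
  using assms unfolding matching_complex_def by auto

lemma matching_in_Gamma: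
  assumes "\<sigma> \<in> matching_complex S T" "S \<subseteq> {1..m}" "T \<subseteq> {1..n}" "\<And>s. 3 \<le> s \<Longrightarrow> (s, 1) \<notin> \<sigma>"
  shows "\<sigma> \<in> Gamma_complex m n"
  using assms unfolding Gamma_complex_def matching_complex_def by fastforce

lemma insert_Gamma:
  assumes "\<tau> \<in> matching_complex {3..m} T" "T \<subseteq> {2..n}" "i \<in> {1, 2}" "i \<le> m" "j \<in> {1..n}" "j \<notin> T"
  shows "insert (i, j) \<tau> \<in> Gamma_complex m n" "(i, j) \<notin> \<tau>"
proof -
  have i: "i \<notin> {3..m}" using assms(3) by auto
  show "(i, j) \<notin> \<tau>" using assms(1) i assms(6) by (rule matching_complex_insert)
  have "(s, 1) \<notin> \<tau>" for s
    using assms(1,2) by (auto simp: matching_complex_def)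
  then show "insert (i, j) \<tau> \<in> Gamma_complex m n"
    by (intro matching_in_Gamma[OF matching_complex_insert(1)[OF assms(1) i assms(6)]])
      (use assms(2-5) in auto)
qed

lemma insert_insert_Gamma:
  assumes "\<tau> \<in> matching_complex {3..m} T" "T \<subseteq> {2..n}" "2 \<le> m"
    "s \<in> {1..n}" "t \<in> {1..n}" "s \<noteq> t" "s \<notin> T" "t \<notin> T"
  shows "insert (1, s) (insert (2, t) \<tau>) \<in> Gamma_complex m n" "(2, t) \<notin> \<tau>" "(1, s) \<notin> insert (2, t) \<tau>"
proof -
  have t: "insert (2, t) \<tau> \<in> matching_complex (insert 2 {3..m}) (insert t T)" "(2, t) \<notin> \<tau>"
    by (rule matching_complex_insert[OF assms(1)]; use assms(8) in simp)+
  have s: "insert (1, s) (insert (2, t) \<tau>) \<in> matching_complex (insert 1 (insert 2 {3..m})) (insert s (insert t T))"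
    "(1, s) \<notin> insert (2, t) \<tau>"
    by (rule matching_complex_insert[OF t(1)]; use assms(6,7) in simp)+
  have "(r, 1) \<notin> \<tau>" for r
    using assms(1,2) by (auto simp: matching_complex_def)
  then show "insert (1, s) (insert (2, t) \<tau>) \<in> Gamma_complex m n"
    by (intro matching_in_Gamma[OF s(1)]) (use assms(2-5) in auto)
  show "(2, t) \<notin> \<tau>" "(1, s) \<notin> insert (2, t) \<tau>" by (fact t(2) s(2))+
qed

lemma prepend_Gamma:
  assumes "w \<in> carrier (chain_module (matching_complex {3..m} T) d)"
    "T \<subseteq> {2..n}" "i \<in> {1, 2}" "i \<le> m" "j \<in> {1..n}" "j \<notin> T"
  shows "prepend (i, j) w \<in> Gamma_chains m n (d + 1)"
  by (rule prepend_chains[OF assms(1)]) (use insert_Gamma[OF _ assms(2-)] in simp)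

lemma prepend_prepend_Gamma:
  assumes w: "w \<in> carrier (chain_module (matching_complex {3..m} T) d)" and T: "T \<subseteq> {2..n}"
    and "2 \<le> m" "s \<in> {1..n}" "t \<in> {1..n}" "s \<noteq> t" "s \<notin> T" "t \<notin> T"
  shows "prepend (1, s) (prepend (2, t) w) \<in> Gamma_chains m n (d + 2)"
proof -
  note ins = insert_insert_Gamma[OF _ T assms(3-)]
  \<comment> \<open>The intermediate set of faces is not closed under subsets. Membership in
    \<open>chain_module\<close> is a condition on supports, so any set of faces can serve as
    target.\<close>
  have "prepend (2, t) w \<in> carrier (chain_module (insert (2, t) ` matching_complex {3..m} T) (d + 1))"
    using ins w by (intro prepend_chains) auto
  then have "prepend (1, s) (prepend (2, t) w) \<in> Gamma_chains m n (d + 1 + 1)"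
    by (rule prepend_chains) (use ins in auto)
  then show ?thesis by (simp add: add.assoc)
qed

context
  fixes m n :: nat
  assumes mn: "2 \<le> m" "1 \<le> n"
begin

lemma iota_chains:
  "w \<in> carrier (chain_module (Q_complex m n) d) \<Longrightarrow> iota w \<in> Gamma_chains m n (d + 1)"
  unfolding Q_complex_def
  using prepend_Gamma[of w m "{2..n}" d n] mn tail_chains[of w m "{2..n}" d]
  by (simp add: iota_tail chains_closed)

lemma kappa_chains:
  assumes "p \<in> R_index n" "y \<in> carrier (chain_module (R_complex m n p) d)"
  shows "kappa p y \<in> Gamma_chains m n (d + 2)"
proof -
  obtain s t where p: "p = (s, t)" "s \<in> {2..n}" "t \<in> {2..n}" "s \<noteq> t"
    using assms by (auto simp: R_index_def)
  note pp = prepend_prepend_Gamma[OF assms(2)[unfolded R_complex_def] Diff_subset mn(1)]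
  show ?thesis
    unfolding kappa_def using p by (intro chains_closed(3) pp) simp_all
qed

lemma R_part_chains:
  assumes "p \<in> R_index n" "c \<in> Gamma_chains m n d"
  shows "R_part p c \<in> carrier (chain_module (R_complex m n p) (d - 2))"
  using head_part_chains[OF assms(2), of "{(1, fst p), (2, snd p)}"]
  by (simp add: R_part_def R_complex_def)

lemma Q_part_chains:
  fixes c :: "(edge, 'f::comm_ring_1) chain"
  assumes "c \<in> Gamma_chains m n d"
  shows "Q_part n c \<in> carrier (chain_module (Q_complex m n) (d - 1))"
proof -
  have "head_part {e} c \<in> carrier (chain_module (Q_complex m n) (d - 1))" for e
    using head_part_chains[OF assms, of "{e}"] unfolding Q_complex_def
    by (auto intro: chains_mono[OF _ matching_complex_mono])
  then show ?thesis
    unfolding Q_part_def by (intro chains_closed chains_sum)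
qed

lemma contraction_chains:
  assumes "c \<in> Gamma_chains m n d"
  shows "contraction n c \<in> Gamma_chains m n (d + 1)"
proof -
  have "head_part {} c \<in> carrier (chain_module (matching_complex {3..m} {2..n}) d)"
    using head_part_chains[OF assms, of "{}"] by simp
  then have "prepend (1, 1) (head_part {} c) \<in> Gamma_chains m n (d + 1)"
    by (rule prepend_Gamma) (use mn in auto)
  \<comment> \<open>One claim covers both sums. Here \<open>e\<close> is the head edge taken off;
    the tail avoids its column and column 1, so both edges can be put in front, and the degree
    becomes \<open>d - 1 + 2\<close>.\<close>
  moreover have "prepend (1, s) (prepend (2, t) (head_part {e} c)) \<in> Gamma_chains m n (d + 1)"
    if "s \<in> {1..n}" "t \<in> {1..n}" "s \<noteq> t" "s \<notin> {2..n} - {snd e}" "t \<notin> {2..n} - {snd e}" for s t e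
    using prepend_prepend_Gamma[OF head_part_chains[OF assms, of "{e}"] _ mn(1) that(1-3)] that
    by (simp add: algebra_simps)
  ultimately show ?thesis
    unfolding contraction_def using mn by (intro chains_closed(2,3) chains_sum) auto
qed

end

section \<open>The exact sequence\<close>

lemma R_module_eq:
  "R_module m n d = direct_sum (R_index n) (\<lambda>p. reduced_homology (R_complex m n p) d)"
  by (simp add: R_module_def R_complex_def case_prod_unfold)

lemma R_module_carrier:
  "carrier (R_module m n d) = (\<Pi>\<^sub>E p\<in>R_index n. homology_class (R_complex m n p) d ` cycles (R_complex m n p) d)"
  unfolding R_module_eq
  by (subst direct_sum_carrier[OF finite_R_index reduced_homology_module]) (simp add: reduced_homology_carrier)

lemma R_module_module: "module coeff_ring (R_module m n d)"
  unfolding R_module_eq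
  by (intro direct_sum_module finite_R_index reduced_homology_module cring_from_type_algebra)

text \<open>Choosing a cycle in every component at once lets the later arguments run on
  chains.\<close>

lemma R_module_rep:
  assumes "x \<in> carrier (R_module m n d)"
  obtains y where "\<forall>p\<in>R_index n. y p \<in> cycles (R_complex m n p) d"
    "x = (\<lambda>p\<in>R_index n. homology_class (R_complex m n p) d (y p))"
proof -
  have "\<forall>p\<in>R_index n. \<exists>y. y \<in> cycles (R_complex m n p) d \<and> x p = homology_class (R_complex m n p) d y"
    using assms by (auto simp: R_module_carrier PiE_iff)
  then obtain y where y: "\<And>p. p \<in> R_index n \<Longrightarrow>
      y p \<in> cycles (R_complex m n p) d \<and> x p = homology_class (R_complex m n p) d (y p)"
    by metis
  moreover have "x = (\<lambda>p\<in>R_index n. homology_class (R_complex m n p) d (y p))"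
    using assms y by (intro extensionalityI[where A = "R_index n"]) (auto simp: R_module_carrier PiE_iff)
  ultimately show thesis using that by blast
qed

lemma R_module_class:
  "(\<And>p. p \<in> R_index n \<Longrightarrow> y p \<in> cycles (R_complex m n p) d) \<Longrightarrow>
    (\<lambda>p\<in>R_index n. homology_class (R_complex m n p) d (y p)) \<in> carrier (R_module m n d)"
  by (auto simp: R_module_carrier)

lemma R_complex_subset: "R_complex m n p \<subseteq> Q_complex m n"
  unfolding R_complex_def Q_complex_def by (intro matching_complex_mono) auto

lemma Q_cycles_tail: "z \<in> cycles (Q_complex m n) d \<Longrightarrow> tail z"
  by (auto simp: cycles_def Q_complex_def intro: tail_chains)

lemma R_cycles_subset: "cycles (R_complex m n p) d \<subseteq> cycles (Q_complex m n) d"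
  unfolding cycles_def using chains_mono[OF _ R_complex_subset] by blast

lemma R_boundaries_subset: "boundaries (R_complex m n p) d \<subseteq> boundaries (Q_complex m n) d"
  unfolding boundaries_def using chains_mono[OF _ R_complex_subset] by blast

text \<open>Every \<open>R_complex m n p\<close> lies in \<open>Q_complex m n\<close>, so
  representatives can be added there as chains.\<close>

lemma phi_star_class:
  assumes "\<And>p. p \<in> R_index n \<Longrightarrow> y p \<in> cycles (R_complex m n p) d"
  shows "phi_star m n d (\<lambda>p\<in>R_index n. homology_class (R_complex m n p) d (y p)) =
    homology_class (Q_complex m n) d (\<Sum>p\<in>R_index n. y p)"
proof -
  have *: "induced_map (\<lambda>z. z) (Q_complex m n) d (homology_class (R_complex m n p) d (y p)) =
      homology_class (Q_complex m n) d (y p)" for p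
    by (rule induced_map_class) (simp_all add: chain_linear_def R_boundaries_subset)
  have y: "y p \<in> cycles (Q_complex m n) d" if "p \<in> R_index n" for p
    using assms[OF that] R_cycles_subset by blast
  have "phi_star m n d (\<lambda>p\<in>R_index n. homology_class (R_complex m n p) d (y p)) =
    (\<Oplus>\<^bsub>reduced_homology (Q_complex m n) d\<^esub>p\<in>R_index n. homology_class (Q_complex m n) d (y p))"
    unfolding phi_star_def Q_module_def
    by (intro abelian_monoid.finsum_cong'[OF reduced_homology_abelian_monoid])
      (auto simp: * y reduced_homology_carrier)
  also have "\<dots> = homology_class (Q_complex m n) d (\<Sum>p\<in>R_index n. y p)"
    by (intro reduced_homology_finsum finite_R_index y)
  finally show ?thesis .
qed

lemma phi_star_hom: "(phi_star m n d :: (nat \<times> nat \<Rightarrow> (edge, 'f::comm_ring_1) chain set) \<Rightarrow> _)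
    \<in> module_hom coeff_ring (R_module m n d) (Q_module m n d)"
  unfolding module_hom_def hom_def mem_Collect_eq monoid.simps partial_object.simps
proof (intro conjI ballI funcsetI)
  fix x assume "x \<in> carrier (R_module m n d :: ('f, _) module)"
  then obtain y where y: "\<forall>p\<in>R_index n. y p \<in> cycles (R_complex m n p) d"
    and x: "x = (\<lambda>p\<in>R_index n. homology_class (R_complex m n p) d (y p))" by (rule R_module_rep)
  have "(\<Sum>p\<in>R_index n. y p) \<in> cycles (Q_complex m n) d"
    using y by (intro cycles_sum subsetD[OF R_cycles_subset]) auto
  then show "phi_star m n d x \<in> carrier (Q_module m n d)"
    using y by (simp add: x phi_star_class Q_module_def reduced_homology_carrier)
  fix r
  have "r \<odot>\<^bsub>R_module m n d\<^esub> x =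
      (\<lambda>p\<in>R_index n. homology_class (R_complex m n p) d (scale r (y p)))"
    by (auto simp: x R_module_eq direct_sum_sel reduced_homology_smult intro!: restrict_ext)
  then show "phi_star m n d (r \<odot>\<^bsub>R_module m n d\<^esub> x) = r \<odot>\<^bsub>Q_module m n d\<^esub> phi_star m n d x"
    using y by (simp add: phi_star_class cycles_closed x Q_module_def reduced_homology_smult scale_sum)
next
  fix x assume "x \<in> carrier (R_module m n d :: ('f, _) module)"
  then obtain y where y: "\<forall>p\<in>R_index n. y p \<in> cycles (R_complex m n p) d"
    and x: "x = (\<lambda>p\<in>R_index n. homology_class (R_complex m n p) d (y p))" by (rule R_module_rep)
  fix x' assume "x' \<in> carrier (R_module m n d :: ('f, _) module)"
  then obtain y' where y': "\<forall>p\<in>R_index n. y' p \<in> cycles (R_complex m n p) d"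
    and x': "x' = (\<lambda>p\<in>R_index n. homology_class (R_complex m n p) d (y' p))" by (rule R_module_rep)
  have "x \<oplus>\<^bsub>R_module m n d\<^esub> x' = (\<lambda>p\<in>R_index n. homology_class (R_complex m n p) d (y p + y' p))"
    by (auto simp: x x' R_module_eq direct_sum_sel reduced_homology_add intro!: restrict_ext)
  then show "phi_star m n d (x \<oplus>\<^bsub>R_module m n d\<^esub> x') = phi_star m n d x \<oplus>\<^bsub>Q_module m n d\<^esub> phi_star m n d x'"
    using y y' by (simp add: phi_star_class cycles_closed x x' Q_module_def reduced_homology_add sum.distrib)
qed

text \<open>The map from the homology of the cone to that of its quotient, taken componentwise. The
  degree \<open>d\<close> is that of the target, two below that of \<open>A\<close>.\<close>

definition psi_star ::
  "nat \<Rightarrow> nat \<Rightarrow> int \<Rightarrow> (edge, 'f::comm_ring_1) chain set \<Rightarrow> nat \<times> nat \<Rightarrow> (edge, 'f) chain set" where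
  "psi_star m n d A = (\<lambda>p\<in>R_index n. induced_map (R_part p) (R_complex m n p) d A)"

section \<open>Induced maps and exactness at the three terms\<close>

context
  fixes m n :: nat
  assumes mn: "2 \<le> m" "1 \<le> n"
begin

lemma iota_cycles: "z \<in> cycles (Q_complex m n) d \<Longrightarrow> iota z \<in> cycles (Gamma_complex m n) (d + 1)"
  using iota_chains[OF mn, of z d] tail_chains[of z m "{2..n}" d]
  by (simp add: cycles_def boundary_iota Q_complex_def iota_simps)

lemma iota_boundaries:
  "iota ` boundaries (Q_complex m n) d \<subseteq> boundaries (Gamma_complex m n) (d + 1)"
proof (intro image_subsetI)
  fix b assume "b \<in> boundaries (Q_complex m n) d"
  then obtain w where w: "w \<in> carrier (chain_module (Q_complex m n) (d + 1))" "b = boundary w"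
    by (auto simp: boundaries_def)
  \<comment> \<open>\<open>iota\<close> anticommutes with the boundary.\<close>
  then have "iota b = boundary (- iota w)"
    using tail_chains[of w m "{2..n}" "d + 1"] by (simp add: boundary_iota boundary_simps Q_complex_def)
  then show "iota b \<in> boundaries (Gamma_complex m n) (d + 1)"
    using iota_chains[OF mn w(1)] by (simp add: boundariesI chains_closed)
qed

lemma R_part_cycles:
  "p \<in> R_index n \<Longrightarrow> c \<in> cycles (Gamma_complex m n) d \<Longrightarrow> R_part p c \<in> cycles (R_complex m n p) (d - 2)"
  using R_part_chains[OF mn, of p c d] R_part_boundary[of c m n d p]
  by (simp add: cycles_def chain_linear_zero[OF part_linear(2)])

lemma R_part_boundaries:
  assumes "p \<in> R_index n"
  shows "R_part p ` boundaries (Gamma_complex m n) d \<subseteq> boundaries (R_complex m n p) (d - 2)"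
proof (intro image_subsetI)
  fix b assume "b \<in> boundaries (Gamma_complex m n) d"
  then obtain c where c: "c \<in> Gamma_chains m n (d + 1)" "b = boundary c"
    by (auto simp: boundaries_def)
  have "R_part p c \<in> carrier (chain_module (R_complex m n p) (d - 2 + 1))"
    using R_part_chains[OF mn assms c(1)] by (simp add: algebra_simps)
  then show "R_part p b \<in> boundaries (R_complex m n p) (d - 2)"
    by (simp add: c R_part_boundary[OF c(1)] boundariesI)
qed

lemma iota_star_class:
  "iota_star m n d (homology_class (Q_complex m n) d z) = homology_class (Gamma_complex m n) (d + 1) (iota z)"
  unfolding iota_star_def by (intro induced_map_class iota_linear iota_boundaries)

lemma iota_star_hom:
  "iota_star m n d \<in> module_hom coeff_ring (Q_module m n d) (reduced_homology (Gamma_complex m n) (d + 1))"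
  unfolding iota_star_def Q_module_def
  by (intro induced_map_hom iota_linear iota_boundaries) (auto intro: iota_cycles)

lemma psi_star_class:
  "psi_star m n (d - 2) (homology_class (Gamma_complex m n) d c) =
    (\<lambda>p\<in>R_index n. homology_class (R_complex m n p) (d - 2) (R_part p c))"
  unfolding psi_star_def by (intro restrict_ext induced_map_class part_linear R_part_boundaries)

lemma psi_star_hom:
  "psi_star m n (d - 2) \<in> module_hom coeff_ring (reduced_homology (Gamma_complex m n) d) (R_module m n (d - 2))"
proof -
  note simps = reduced_homology_simps psi_star_class chain_linear_simps[OF part_linear(2)]
  show ?thesis
    unfolding module_hom_def hom_def
    by (auto simp: simps R_module_eq direct_sum_sel intro!: restrict_ext)
      (auto simp: R_module_carrier R_part_cycles simps simp flip: R_module_eq)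
qed

text \<open>This expresses that the connecting map of the cone is \<phi>. For cycles
  \<open>y p\<close>, the chain \<open>kappa p (y p)\<close> bounds \<open>iota (y p)\<close>.
  Conversely, applying \<open>Q_part\<close> to \<open>iota z = boundary c\<close> writes
  \<open>z\<close> as the sum of the \<open>R_part p c\<close> up to a boundary.\<close>

lemma exact_at_Q:
  "exact_at coeff_ring (R_module m n d) (phi_star m n d) (Q_module m n d)
    (iota_star m n d :: (edge, 'f::comm_ring_1) chain set \<Rightarrow> _) (reduced_homology (Gamma_complex m n) (d + 1))"
  unfolding exact_at_def
proof (intro conjI)
  show "phi_star m n d ` carrier (R_module m n d) = kernel (add_monoid (Q_module m n d))
      (add_monoid (reduced_homology (Gamma_complex m n) (d + 1))) (iota_star m n d :: (edge, 'f) chain set \<Rightarrow> _)"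
  proof (intro equalityI subsetI)
    fix A assume "A \<in> phi_star m n d ` carrier (R_module m n d :: ('f, _) module)"
    then obtain x where x: "x \<in> carrier (R_module m n d :: ('f, _) module)" "A = phi_star m n d x"
      by blast
    obtain y where y: "\<forall>p\<in>R_index n. y p \<in> cycles (R_complex m n p) d"
      and x_eq: "x = (\<lambda>p\<in>R_index n. homology_class (R_complex m n p) d (y p))"
      using x(1) by (rule R_module_rep)
    have A: "A = homology_class (Q_complex m n) d (\<Sum>p\<in>R_index n. y p)"
      using y by (simp add: x x_eq phi_star_class)
    have yc: "y p \<in> carrier (chain_module (R_complex m n p) d)" "boundary (y p) = 0" "tail (y p)"
      if "p \<in> R_index n" for p
      using y that tail_chains[of "y p"] by (auto simp: cycles_def R_complex_def)
    have eq: "iota (\<Sum>p\<in>R_index n. y p) = boundary (\<Sum>p\<in>R_index n. kappa p (y p))"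
      by (simp add: iota_simps boundary_simps boundary_kappa yc chain_linear_zero[OF part_linear(3)])
    have "(\<Sum>p\<in>R_index n. kappa p (y p)) \<in> Gamma_chains m n (d + 1 + 1)"
      using kappa_chains[OF mn _ yc(1)] by (intro chains_sum) (simp add: add.assoc)
    then have "iota (\<Sum>p\<in>R_index n. y p) \<in> boundaries (Gamma_complex m n) (d + 1)"
      unfolding eq by (rule boundariesI)
    moreover have "(\<Sum>p\<in>R_index n. y p) \<in> cycles (Q_complex m n) d"
      using y by (intro cycles_sum subsetD[OF R_cycles_subset]) auto
    ultimately show "A \<in> kernel (add_monoid (Q_module m n d))
      (add_monoid (reduced_homology (Gamma_complex m n) (d + 1))) (iota_star m n d)"
      by (auto simp: A kernel_def Q_module_def reduced_homology_simps iota_star_class homology_class_eq_iff)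
  next
    fix A assume "A \<in> kernel (add_monoid (Q_module m n d))
      (add_monoid (reduced_homology (Gamma_complex m n) (d + 1))) (iota_star m n d :: (edge, 'f) chain set \<Rightarrow> _)"
    then obtain z :: "(edge, 'f) chain" where z: "z \<in> cycles (Q_complex m n) d"
      and A: "A = homology_class (Q_complex m n) d z"
      and "iota_star m n d A = homology_class (Gamma_complex m n) (d + 1) 0"
      by (auto simp: kernel_def Q_module_def reduced_homology_carrier reduced_homology_zero)
    then have "iota z \<in> boundaries (Gamma_complex m n) (d + 1)"
      by (simp add: iota_star_class homology_class_eq_iff)
    then obtain c where c: "c \<in> Gamma_chains m n (d + 1 + 1)" "iota z = boundary c"
      by (auto simp: boundaries_def)
    have tz: "tail z" using z by (rule Q_cycles_tail)
    \<comment> \<open>The two-edge part of \<open>c\<close> is closed because its boundary is the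
      two-edge part of \<open>iota z\<close>, which is 0.\<close>
    have y: "R_part p c \<in> cycles (R_complex m n p) d" if "p \<in> R_index n" for p
      using R_part_chains[OF mn that c(1)] R_part_boundary[OF c(1), of p] R_part_iota[OF tz, of p] c(2)
      by (simp add: cycles_def)
    have "z = (\<Sum>p\<in>R_index n. R_part p c) - boundary (Q_part n c)"
      using Q_part_boundary[OF c(1)] Q_part_iota[OF tz, of n] c(2) by simp
    then have "z - (\<Sum>p\<in>R_index n. R_part p c) = boundary (- Q_part n c)"
      by (simp only: boundary_simps) simp
    also have "\<dots> \<in> boundaries (Q_complex m n) d"
      using Q_part_chains[OF mn c(1)] by (intro boundariesI chains_closed) (simp add: add.commute)
    finally have "A = phi_star m n d (\<lambda>p\<in>R_index n. homology_class (R_complex m n p) d (R_part p c))"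
      using y by (simp add: A phi_star_class homology_class_eq_iff)
    then show "A \<in> phi_star m n d ` carrier (R_module m n d)"
      using R_module_class[of n "\<lambda>p. R_part p c" m d] y by blast
  qed
qed (simp_all add: R_module_module Q_module_def reduced_homology_module phi_star_hom[unfolded Q_module_def]
    iota_star_hom[unfolded Q_module_def])

lemma exact_at_Gamma:
  "exact_at coeff_ring (Q_module m n (d - 1)) (iota_star m n (d - 1)) (reduced_homology (Gamma_complex m n) d)
    (psi_star m n (d - 2)) (R_module m n (d - 2) :: ('f::comm_ring_1, _) module)"
  unfolding exact_at_def
proof (intro conjI)
  show "iota_star m n (d - 1) ` carrier (Q_module m n (d - 1)) =
    kernel (add_monoid (reduced_homology (Gamma_complex m n) d))
      (add_monoid (R_module m n (d - 2) :: ('f::comm_ring_1, _) module)) (psi_star m n (d - 2))"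
  proof (intro equalityI subsetI)
    fix A assume "A \<in> iota_star m n (d - 1) ` carrier (Q_module m n (d - 1) :: ('f, _) module)"
    then obtain z :: "(edge, 'f) chain" where z: "z \<in> cycles (Q_complex m n) (d - 1)"
      and A: "A = homology_class (Gamma_complex m n) d (iota z)"
      by (auto simp: Q_module_def reduced_homology_carrier iota_star_class)
    have "tail z" using z by (rule Q_cycles_tail)
    then show "A \<in> kernel (add_monoid (reduced_homology (Gamma_complex m n) d))
        (add_monoid (R_module m n (d - 2))) (psi_star m n (d - 2))"
      using iota_cycles[OF z]
      by (auto simp: A kernel_def R_module_eq direct_sum_sel psi_star_class reduced_homology_simps R_part_iota)
  next
    fix A assume "A \<in> kernel (add_monoid (reduced_homology (Gamma_complex m n) d))
      (add_monoid (R_module m n (d - 2) :: ('f::comm_ring_1, _) module)) (psi_star m n (d - 2))"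
    then obtain c :: "(edge, 'f) chain" where c: "c \<in> cycles (Gamma_complex m n) d"
      and A: "A = homology_class (Gamma_complex m n) d c"
      and psi: "(\<lambda>p\<in>R_index n. homology_class (R_complex m n p) (d - 2) (R_part p c)) =
        (\<lambda>p\<in>R_index n. homology_class (R_complex m n p) (d - 2) 0)"
      by (auto simp: kernel_def R_module_eq direct_sum_sel psi_star_class reduced_homology_simps)
    have "\<forall>p\<in>R_index n. R_part p c \<in> boundaries (R_complex m n p) (d - 2)"
    proof
      fix p assume "p \<in> R_index n"
      then show "R_part p c \<in> boundaries (R_complex m n p) (d - 2)"
        using fun_cong[OF psi, of p] by (simp add: homology_class_eq_iff)
    qed
    then have "\<forall>p\<in>R_index n. \<exists>b. b \<in> carrier (chain_module (R_complex m n p) (d - 1)) \<and> R_part p c = boundary b"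
      by (auto simp: boundaries_def)
    then obtain b where b: "\<And>p. p \<in> R_index n \<Longrightarrow> b p \<in> carrier (chain_module (R_complex m n p) (d - 1))"
        "\<And>p. p \<in> R_index n \<Longrightarrow> R_part p c = boundary (b p)"
      by metis
    have tb: "tail (b p)" if "p \<in> R_index n" for p
      using b(1)[OF that] tail_chains[of "b p"] by (simp add: R_complex_def)
    have c': "c \<in> Gamma_chains m n d" "boundary c = 0" using c by (auto simp: cycles_def)
    \<comment> \<open>The boundary of \<open>Q_part n c\<close> is the sum of the
      \<open>R_part p c\<close>, that is, of the \<open>boundary (b p)\<close>; subtracting the
      \<open>b p\<close> turns it into a cycle.\<close>
    define z where "z = Q_part n c - (\<Sum>p\<in>R_index n. b p)"
    have "z \<in> carrier (chain_module (Q_complex m n) (d - 1))"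
      unfolding z_def
      by (intro chains_closed chains_sum Q_part_chains[OF mn c'(1)] chains_mono[OF b(1) R_complex_subset])
    moreover have "boundary z = 0"
      using Q_part_boundary[OF c'(1)] c'(2) b(2)
      by (simp add: z_def boundary_simps chain_linear_zero[OF part_linear(1)])
    ultimately have z: "z \<in> cycles (Q_complex m n) (d - 1)" by (simp add: cycles_def)
    \<comment> \<open>The homotopy makes the first bracket a boundary, since \<open>c\<close> is a
      cycle. In the second sum \<open>kappa p (boundary (b p))\<close> undoes the subtraction in the
      bracket, and by \<open>boundary_kappa\<close> each summand is
      \<open>boundary (kappa p (b p))\<close>.\<close>
    have "c - iota z = (c - iota (Q_part n c) - (\<Sum>p\<in>R_index n. kappa p (R_part p c)))
        + (\<Sum>p\<in>R_index n. iota (b p) + kappa p (boundary (b p)))"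
      by (simp add: z_def iota_simps b(2) sum.distrib)
    also have "\<dots> = boundary (contraction n c + (\<Sum>p\<in>R_index n. kappa p (b p)))"
      by (simp add: contraction_homotopy[OF c'(1)] c'(2) chain_linear_zero[OF part_linear(4)]
          boundary_simps boundary_kappa tb)
    also have "\<dots> \<in> boundaries (Gamma_complex m n) d"
    proof (intro boundariesI chains_closed chains_sum contraction_chains[OF mn c'(1)])
      fix p assume p: "p \<in> R_index n"
      have "kappa p (b p) \<in> Gamma_chains m n (d - 1 + 2)"
        by (rule kappa_chains[OF mn p b(1)[OF p]])
      then show "kappa p (b p) \<in> Gamma_chains m n (d + 1)"
        by (simp add: algebra_simps)
    qed
    finally have "A = iota_star m n (d - 1) (homology_class (Q_complex m n) (d - 1) z)"
      by (simp add: A iota_star_class homology_class_eq_iff)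
    then show "A \<in> iota_star m n (d - 1) ` carrier (Q_module m n (d - 1))"
      using z by (auto simp: Q_module_def reduced_homology_carrier)
  qed
qed (use iota_star_hom[of "d - 1"] in
    \<open>simp_all add: R_module_module Q_module_def reduced_homology_module psi_star_hom\<close>)

lemma exact_at_R:
  "exact_at coeff_ring (reduced_homology (Gamma_complex m n) d) (psi_star m n (d - 2))
    (R_module m n (d - 2)) (phi_star m n (d - 2)) (Q_module m n (d - 2) :: ('f::comm_ring_1, _) module)"
  unfolding exact_at_def
proof (intro conjI)
  show "psi_star m n (d - 2) ` carrier (reduced_homology (Gamma_complex m n) d) =
    kernel (add_monoid (R_module m n (d - 2)))
      (add_monoid (Q_module m n (d - 2) :: ('f::comm_ring_1, _) module)) (phi_star m n (d - 2))"
  proof (intro equalityI subsetI)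
    fix x assume "x \<in> psi_star m n (d - 2) ` carrier (reduced_homology (Gamma_complex m n) d :: ('f, _) module)"
    then obtain c :: "(edge, 'f) chain" where c: "c \<in> cycles (Gamma_complex m n) d"
      and x: "x = (\<lambda>p\<in>R_index n. homology_class (R_complex m n p) (d - 2) (R_part p c))"
      by (auto simp: reduced_homology_carrier psi_star_class)
    have c': "c \<in> Gamma_chains m n d" "boundary c = 0" using c by (auto simp: cycles_def)
    have y: "R_part p c \<in> cycles (R_complex m n p) (d - 2)" if "p \<in> R_index n" for p
      using R_part_cycles[OF that c] .
    \<comment> \<open>\<open>Q_part n c\<close> bounds the sum because \<open>c\<close> is a cycle,
      so \<phi> after \<psi> vanishes.\<close>
    have "(\<Sum>p\<in>R_index n. R_part p c) = boundary (Q_part n c)"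
      using Q_part_boundary[OF c'(1)] c'(2) by (simp add: chain_linear_zero[OF part_linear(1)])
    also have "\<dots> \<in> boundaries (Q_complex m n) (d - 2)"
      using Q_part_chains[OF mn c'(1)] by (intro boundariesI) simp
    finally show "x \<in> kernel (add_monoid (R_module m n (d - 2)))
      (add_monoid (Q_module m n (d - 2))) (phi_star m n (d - 2))"
      using R_module_class[of n "\<lambda>p. R_part p c" m "d - 2"] y
      by (simp add: x kernel_def phi_star_class Q_module_def reduced_homology_zero homology_class_eq_iff)
  next
    fix x assume "x \<in> kernel (add_monoid (R_module m n (d - 2)))
      (add_monoid (Q_module m n (d - 2) :: ('f::comm_ring_1, _) module)) (phi_star m n (d - 2))"
    then have x: "x \<in> carrier (R_module m n (d - 2))"
      and phi: "phi_star m n (d - 2) x = homology_class (Q_complex m n) (d - 2) 0"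
      by (auto simp: kernel_def Q_module_def reduced_homology_zero)
    obtain y where y: "\<forall>p\<in>R_index n. y p \<in> cycles (R_complex m n p) (d - 2)"
      and x_eq: "x = (\<lambda>p\<in>R_index n. homology_class (R_complex m n p) (d - 2) (y p))"
      using x by (rule R_module_rep)
    have "(\<Sum>p\<in>R_index n. y p) \<in> boundaries (Q_complex m n) (d - 2)"
      using phi y by (simp add: x_eq phi_star_class homology_class_eq_iff)
    then obtain w where w: "w \<in> carrier (chain_module (Q_complex m n) (d - 1))"
      "(\<Sum>p\<in>R_index n. y p) = boundary w"
      by (auto simp: boundaries_def)
    have tw: "tail w" using w tail_chains[of w m "{2..n}"] by (simp add: Q_complex_def)
    have yc: "y p \<in> carrier (chain_module (R_complex m n p) (d - 2))" "boundary (y p) = 0" "tail (y p)"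
      if "p \<in> R_index n" for p
      using y that tail_chains[of "y p"] by (auto simp: cycles_def R_complex_def)
    \<comment> \<open>The image of the cone cycle with components \<open>w\<close> and
      \<open>y\<close>: the boundary of the first sum is the sum of the \<open>iota (y p)\<close>,
      that of \<open>iota w\<close> is \<open>- iota (boundary w)\<close>, and these cancel.\<close>
    define c where "c = (\<Sum>p\<in>R_index n. kappa p (y p)) + iota w"
    have "c \<in> Gamma_chains m n d"
      using kappa_chains[OF mn _ yc(1)] iota_chains[OF mn w(1)] unfolding c_def
      by (intro chains_closed chains_sum) auto
    moreover have "boundary c = 0"
      by (simp add: c_def boundary_simps boundary_kappa boundary_iota tw yc
          chain_linear_zero[OF part_linear(3)] flip: w(2) iota_simps(6))
    ultimately have c: "c \<in> cycles (Gamma_complex m n) d" by (simp add: cycles_def)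
    have "R_part p c = y p" if "p \<in> R_index n" for p
      using that
      by (simp add: c_def chain_linear_simps[OF part_linear(2)] R_part_iota[OF tw] R_part_kappa[OF yc(3)]
          finite_R_index cong: sum.cong)
    then have "x = psi_star m n (d - 2) (homology_class (Gamma_complex m n) d c)"
      unfolding psi_star_class x_eq by (intro restrict_ext) simp
    then show "x \<in> psi_star m n (d - 2) ` carrier (reduced_homology (Gamma_complex m n) d)"
      using c by (auto simp: reduced_homology_carrier)
  qed
qed (simp_all add: R_module_module Q_module_def reduced_homology_module psi_star_hom
    phi_star_hom[unfolded Q_module_def])

end

theorem theorem2p4:
  fixes m n :: nat
  assumes "m \<ge> 2" and "n \<ge> 3"
  shows "(\<forall>d. \<forall>z \<in> cycles (Q_complex m n) d.
            (iota z :: (edge, 'f::comm_ring_1) chain) \<in> cycles (Gamma_complex m n) (d + 1)) \<and>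
    (\<exists>\<psi> :: int \<Rightarrow> (edge, 'f) chain set \<Rightarrow> (nat \<times> nat \<Rightarrow> (edge, 'f) chain set).
      \<forall>d :: int.
        exact_at coeff_ring
          (R_module m n (d - 1)) (phi_star m n (d - 1))
          (Q_module m n (d - 1)) (iota_star m n (d - 1))
          (reduced_homology (Gamma_complex m n) d) \<and>
        exact_at coeff_ring
          (Q_module m n (d - 1)) (iota_star m n (d - 1))
          (reduced_homology (Gamma_complex m n) d) (\<psi> d)
          (R_module m n (d - 2)) \<and>
        exact_at coeff_ring
          (reduced_homology (Gamma_complex m n) d) (\<psi> d)
          (R_module m n (d - 2)) (phi_star m n (d - 2))
          (Q_module m n (d - 2)))"
proof -
  have mn: "2 \<le> m" "1 \<le> n" using assms by simp_all
  show ?thesis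
  proof (intro conjI exI[of _ "\<lambda>d. psi_star m n (d - 2) :: (edge, 'f) chain set \<Rightarrow> _"] allI ballI, goal_cases)
    case (1 d z)
    then show ?case by (rule iota_cycles[OF mn])
  next
    case (2 d)
    \<comment> \<open>Exactness at Q was proved with \<Gamma> in degree \<open>d + 1\<close>; at
      \<open>d - 1\<close> this is degree \<open>d\<close>.\<close>
    show ?case using exact_at_Q[OF mn, of "d - 1"] by simp
  next
    case (3 d)
    show ?case by (rule exact_at_Gamma[OF mn])
  next
    case (4 d)
    show ?case by (rule exact_at_R[OF mn])
  qed
qed

end
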